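(* There is an absolute constant $C>0$ such that the following holds. Let $G$ be an Abelian group, let $A\subset G$ be a finite non-empty set, and let $K\geq 1$ be such that $|A+A|\leq K|A|$. Then there are a finite non-empty set $X\subset G$ and a set $Y\subset G$ which is a translate of $X-X$ such that $$|A\cap Y|\geq \exp\left(-C(1+\log K)^{C}\right)|A|,\qquad |A\cap Y|\geq \frac{|Y|}{C K^{C}},$$ and $$|nX|\leq n^{C(1+\log K)^{C}}|X|\quad\text{for all integers } n\geq 1.$$
   Context: For subsets $S,T$ of an Abelian group, $S+T=\{s+t:s\in S,t\in T\}$, $S-T=\{s-t:s\in S,t\in T\}$, and for an integer $n\ge 1$, $nX=\{x_1+\dots+x_n : x_1,\dots,x_n\in X\}$ is the $n$-fold sumset. A translate of a set $S$ is a set $g+S$ with $g\in G$. *)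

theory Defs
  imports Complex_Main "HOL-Algebra.Coset" "HOL-Algebra.FiniteProduct"
begin

text \<open>
  Abelian groups are commutative groups in the sense of HOL-Algebra, hence written
  multiplicatively: the sumset \<open>S + T\<close> is \<open>S <#>\<^bsub>G\<^esub> T\<close>, the set \<open>- S\<close> is
  \<open>set_inv\<^bsub>G\<^esub> S\<close>, and the translate \<open>g + S\<close> is \<open>g <#\<^bsub>G\<^esub> S\<close>.
\<close>

definition diffset :: "('a, 'b) monoid_scheme \<Rightarrow> 'a set \<Rightarrow> 'a set \<Rightarrow> 'a set" where
  "diffset G S T = S <#>\<^bsub>G\<^esub> (set_inv\<^bsub>G\<^esub> T)"

definition nfold_sumset :: "('a, 'b) monoid_scheme \<Rightarrow> nat \<Rightarrow> 'a set \<Rightarrow> 'a set" where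
  "nfold_sumset G n X = {\<Otimes>\<^bsub>G\<^esub>i\<in>{1..n}. x i | x. x \<in> {1..n} \<rightarrow> X}"

text \<open>
  \<open>structure_const C G\<close>: the constant \<open>C\<close> works for every set of small doubling in the group
  \<open>G\<close>. Since \<open>K \<ge> 1\<close> and \<open>n \<ge> 1\<close>, all bases of \<open>powr\<close> below are at least \<open>1\<close>.
\<close>

definition structure_const :: "real \<Rightarrow> ('a, 'b) monoid_scheme \<Rightarrow> bool" where
  "structure_const C G \<longleftrightarrow>
    (\<forall>A K. A \<subseteq> carrier G \<longrightarrow> finite A \<longrightarrow> A \<noteq> {} \<longrightarrow> K \<ge> 1 \<longrightarrow>
        real (card (A <#>\<^bsub>G\<^esub> A)) \<le> K * real (card A) \<longrightarrow>
      (\<exists>X Y. X \<subseteq> carrier G \<and> finite X \<and> X \<noteq> {} \<and>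
        (\<exists>g\<in>carrier G. Y = g <#\<^bsub>G\<^esub> diffset G X X) \<and>
        real (card (A \<inter> Y)) \<ge> exp (- (C * (1 + ln K) powr C)) * real (card A) \<and>
        real (card (A \<inter> Y)) \<ge> real (card Y) / (C * K powr C) \<and>
        (\<forall>n::nat. n \<ge> 1 \<longrightarrow>
          real (card (nfold_sumset G n X)) \<le> real n powr (C * (1 + ln K) powr C) * real (card X))))"

text \<open>
  The constant in the theorem must not depend on the group, so in particular not on the type of
  its elements, but HOL has no quantification over types inside a formula: a polymorphic
  statement \<open>\<exists>C>0. \<forall>G :: 'a monoid. ...\<close> would allow a different \<open>C\<close> for every \<open>'a\<close>. The theorem
  therefore asserts that a constant exists for all Abelian groups on subsets of \<^typ>\<open>nat\<close>, and
  that any such constant works for all Abelian groups over an arbitrary type \<open>'a\<close>. Together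
  these give one and the same \<open>C\<close> for all types. Nothing is lost in the converse direction:
  \<open>A\<close> lies in the subgroup it generates, which is countable and so isomorphic to a group on a
  subset of \<^typ>\<open>nat\<close>.
\<close>

end

theory Submission
  imports Defs "HOL-Library.Set_Algebras" "HOL-Library.Function_Algebras" "HOL-Library.FuncSet"
    "HOL-Library.Countable_Set" "HOL-Algebra.Generated_Groups"
begin

text \<open>
  The proof follows the route of Croot and Sisask and of Sanders, with Chang's theorem replaced by
  random sampling of characters. Write \<open>L = 1 + log K\<close>.

  Sampling translates of \<open>A + A\<close> shows that some level set \<open>B \<subseteq> 2A - A\<close> of
  \<open>x \<mapsto> |(A + A) \<inter> (x + A)| / |A|\<close> is nearly invariant under \<open>T - T\<close>, where
  \<open>|T| \<ge> exp (- O(L\<^sup>4)) |A|\<close>. The autocorrelation \<open>g\<close> of \<open>B\<close> is positive definite, hence an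
  average of characters; let \<open>\<psi>\<^sub>1, \<dots>, \<psi>\<^sub>d\<close> be a random sample of size \<open>d = O(L\<^sup>4)\<close> and \<open>g'\<close> its
  average. If \<open>x \<in> 6A - 6A\<close> lies in the Bohr set of the sample but not in \<open>B - B\<close>, then on many points
  of \<open>x + T - T\<close> the function \<open>g\<close> is near \<open>0\<close> while \<open>g'\<close> is near \<open>1\<close>; a Chernoff bound leaves only
  \<open>exp (- \<Omega>(d)) |7A - 7A| < |T| / 4\<close> such points. Hence inside \<open>6A - 6A\<close> the Bohr set stays in
  \<open>3A - 3A\<close>, so the Bohr set \<open>X\<close> of width \<open>1/k\<close> satisfies \<open>kX \<subseteq> 3A - 3A\<close> and
  \<open>|X| \<ge> k\<^bsup>-O(d)\<^esup> |A|\<close>. With \<open>k \<approx> d\<^sup>2\<close>, Chang's covering argument gives polynomial growth of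
  \<open>nX\<close>, and \<open>Y\<close> is found by averaging over translates of \<open>X - X \<subseteq> 3A - 3A\<close>.
\<close>

section \<open>Sumsets and Pluennecke's inequality\<close>

text \<open>Chang's theorem would bound the dimension of a large spectrum; a sample of
  \<open>d\<close> characters has bounded dimension by construction. The price is that the Bohr set
  is understood only inside 6A - 6A. This suffices because the sum of two elements of 3A - 3A lies
  in 6A - 6A, where the Bohr condition brings it back to 3A - 3A; with width 1/k this can be
  repeated k times. The powers of \<open>L\<close> come from nested choices. Among n = O(L) levels
  between 1 and 1/2, some consecutive two have nearly equal level sets. Sampling to accuracy of
  order 1/n takes l = O(n^2 L) = O(L^3) translates and costs a factor K^l in |T|. A union bound over
  7A - 7A against |T| then needs d = O(l L) characters, and covering turns this into the growth
  exponent O(d^2) = O(L^8). The power of \<open>K\<close> in the second bound has a different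
  source: the translates of X - X that meet A start in 4A - 3A, so only Pluennecke's inequality
  enters there. An infinite group offers no finite dual to draw from. Exact orthogonality is needed
  only at finitely many points, and there finitely many characters provide it.\<close>

primrec nsum :: "nat \<Rightarrow> 'a::ab_group_add set \<Rightarrow> 'a set" where
  "nsum 0 A = {0}"
| "nsum (Suc n) A = A + nsum n A"

definition mixsum :: "nat \<Rightarrow> nat \<Rightarrow> 'a::ab_group_add set \<Rightarrow> 'a set" where
  "mixsum m n A = nsum m A + uminus ` nsum n A"

lemma nsum_1 [simp]: "nsum (Suc 0) A = A"
  by (auto simp: set_plus_def)

lemma nsum_add: "nsum (m + n) A = nsum m A + nsum n A"
proof (induction m)
  case 0
  show ?case by (auto simp: set_plus_def)
next
  case (Suc m)
  then show ?case by (simp add: add.assoc)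
qed

lemma finite_nsum: "finite A \<Longrightarrow> finite (nsum n A)"
  by (induction n) (auto intro: finite_set_plus)

lemma nsum_nonempty: "A \<noteq> {} \<Longrightarrow> nsum n A \<noteq> {}"
  by (induction n) (auto simp: set_plus_def)

lemma nsum_set_plus: "nsum n (A + B) = nsum n A + nsum n B"
proof (induction n)
  case 0
  show ?case by (auto simp: set_plus_def)
next
  case (Suc n)
  then show ?case by (simp add: add.assoc add.left_commute)
qed

lemma uminus_set_plus: "uminus ` (A + B) = uminus ` A + uminus ` (B::'a::ab_group_add set)"
proof -
  have "uminus ` (A + B) = (\<lambda>(x, y). - (x + y)) ` (A \<times> B)"
    by (simp add: set_plus_image image_image case_prod_unfold)
  also have "\<dots> = (\<lambda>(x, y). x + y) ` (map_prod uminus uminus ` (A \<times> B))"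
    by (simp add: image_image case_prod_unfold)
  also have "map_prod uminus uminus ` (A \<times> B) = (uminus ` A) \<times> (uminus ` B)"
    by (simp add: map_prod_surj_on)
  finally show ?thesis
    by (simp add: set_plus_image)
qed

lemma nsum_uminus: "nsum n (uminus ` A) = uminus ` nsum n A"
  by (induction n) (simp_all add: uminus_set_plus)

lemma finite_mixsum: "finite A \<Longrightarrow> finite (mixsum m n A)"
  by (simp add: mixsum_def finite_set_plus finite_nsum)

lemma mixsum_add: "mixsum m n A + mixsum m' n' A = mixsum (m + m') (n + n') A"
  by (simp add: mixsum_def nsum_add uminus_set_plus add.assoc add.left_commute)

lemma uminus_mixsum: "uminus ` mixsum m n A = mixsum n m A"
  by (simp add: mixsum_def uminus_set_plus image_image add.commute)

lemma mixsum_1_0 [simp]: "mixsum (Suc 0) 0 A = A"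
  by (auto simp: mixsum_def set_plus_def)

lemma zero_in_mixsum: "A \<noteq> {} \<Longrightarrow> 0 \<in> mixsum n n A"
  using nsum_nonempty[of A n] by (force simp: mixsum_def set_plus_def)

lemma mixsum_subset_mixsum:
  assumes "A \<noteq> {}"
  shows "mixsum m n A \<subseteq> mixsum (m + k) (n + k) A"
  using set_zero_plus2[OF zero_in_mixsum[OF assms, of k], of "mixsum m n A"]
  by (simp add: mixsum_add add.commute)

lemma card_set_plus_sing: "card ({x} + A) = card (A::'a::ab_group_add set)"
proof -
  have "{x} + A = (\<lambda>y. x + y) ` A" by (auto simp: set_plus_def)
  then show ?thesis by (simp add: card_image)
qed

text \<open>Induction on \<open>C\<close>, one point \<open>c\<close> at a time. The part of
  \<open>c + X\<close> already present is \<open>c + W\<close>, and \<open>Z\<close>, the set of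
  \<open>x\<close> with \<open>c + x + A\<close> already covered, contains \<open>W\<close>.
  Minimality gives \<open>|Z + A| \<ge> \<kappa> * |W|\<close>, so each step adds to the left at
  most \<open>\<kappa>\<close> times what it adds to the right.\<close>

lemma petridis:
  fixes X A C :: "'a::ab_group_add set" and \<kappa> :: real
  assumes fin: "finite X" "finite A" "finite C" and "\<kappa> \<ge> 0"
    and ratio: "real (card (X + A)) \<le> \<kappa> * real (card X)"
    and minim: "\<And>Z. Z \<subseteq> X \<Longrightarrow> \<kappa> * real (card Z) \<le> real (card (Z + A))"
  shows "real (card (C + (X + A))) \<le> \<kappa> * real (card (C + X))"
  using \<open>finite C\<close>
proof (induction C rule: finite_induct)
  case empty
  show ?case by simp
next
  case (insert c C)
  define P where "P = C + (X + A)"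
  define Q where "Q = C + X"
  define Z where "Z = {x\<in>X. {c + x} + A \<subseteq> P}"
  define W where "W = {x\<in>X. c + x \<in> Q}"
  have finPQ: "finite P" "finite Q"
    using fin insert by (auto simp: P_def Q_def intro!: finite_set_plus)
  have finZW: "finite Z" "finite W" "Z \<subseteq> X" "W \<subseteq> X"
    using fin by (auto simp: Z_def W_def)
  have PQ: "P = Q + A" by (simp add: P_def Q_def add.assoc)
  have WZ: "W \<subseteq> Z"
    by (auto simp: W_def Z_def PQ set_plus_def)
  have eqP: "insert c C + (X + A) = P \<union> ({c} + (X + A) - ({c} + (Z + A)))"
  proof -
    have "insert c C + (X + A) = P \<union> ({c} + (X + A))"
      by (auto simp: P_def set_plus_def)
    moreover have "{c} + (Z + A) \<subseteq> P"
      by (auto simp: Z_def set_plus_def add.assoc)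
    ultimately show ?thesis by blast
  qed
  have "card (insert c C + (X + A)) \<le> card P + card ({c} + (X + A) - ({c} + (Z + A)))"
    unfolding eqP by (rule card_Un_le)
  also have "card ({c} + (X + A) - ({c} + (Z + A))) = card (X + A) - card (Z + A)"
    using finZW fin by (subst card_Diff_subset)
      (simp_all add: card_set_plus_sing finite_set_plus set_plus_mono2)
  finally have 1: "real (card (insert c C + (X + A))) \<le> card P + (real (card (X + A)) - card (Z + A))"
    using finZW fin card_mono[of "X + A" "Z + A"] 
    by (simp add: finite_set_plus set_plus_mono2 of_nat_diff flip: of_nat_add)
  have eqQ: "insert c C + X = Q \<union> ({c} + X - ({c} + W))"
  proof -
    have "insert c C + X = Q \<union> ({c} + X)"
      by (auto simp: Q_def set_plus_def)
    moreover have "{c} + W \<subseteq> Q"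
      by (auto simp: W_def set_plus_def)
    ultimately show ?thesis by blast
  qed
  have "card (insert c C + X) = card Q + card ({c} + X - ({c} + W))"
    unfolding eqQ using fin finPQ
    by (subst card_Un_disjoint) (auto simp: W_def set_plus_def intro!: finite_set_plus)
  also have "card ({c} + X - ({c} + W)) = card X - card W"
    using finZW fin by (subst card_Diff_subset)
      (simp_all add: card_set_plus_sing finite_set_plus set_plus_mono2)
  finally have 2: "real (card (insert c C + X)) = card Q + (real (card X) - card W)"
    using finZW fin card_mono[of X W] by (simp add: of_nat_diff)
  have "real (card W) \<le> card Z" using WZ finZW by (simp add: card_mono)
  then have "\<kappa> * card W \<le> card (Z + A)"
    using minim[of Z] finZW \<open>\<kappa> \<ge> 0\<close> by (meson mult_left_mono order_trans)
  moreover have "\<kappa> * card (insert c C + X) = \<kappa> * card Q + (\<kappa> * card X - \<kappa> * card W)"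
    unfolding 2 by (simp add: algebra_simps)
  ultimately show ?case
    using 1 ratio insert.IH unfolding P_def Q_def by linarith
qed

text \<open>Once a representation \<open>d = u d - v d\<close> is fixed for each difference, the
  pair \<open>(u d + y, v d + y)\<close> determines \<open>d\<close> by subtraction, and then
  \<open>y\<close>.\<close>

lemma ruzsa_triangle:
  fixes U V Y :: "'a::ab_group_add set"
  assumes fin: "finite U" "finite V" "finite Y"
  shows "card Y * card (U + uminus ` V) \<le> card (U + Y) * card (V + Y)"
proof -
  have "\<exists>u v. u \<in> U \<and> v \<in> V \<and> d = u - v" if "d \<in> U + uminus ` V" for d
    using that by (auto simp: set_plus_def)
  then obtain u v where uv: "\<And>d. d \<in> U + uminus ` V \<Longrightarrow> u d \<in> U \<and> v d \<in> V \<and> d = u d - v d"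
    by metis
  define \<phi> where "\<phi> = (\<lambda>(y, d). (u d + y, v d + y))"
  have "inj_on \<phi> (Y \<times> (U + uminus ` V))"
  proof (rule inj_onI, clarify)
    fix y d y' d'
    assume *: "y \<in> Y" "d \<in> U + uminus ` V" "y' \<in> Y" "d' \<in> U + uminus ` V" "\<phi> (y, d) = \<phi> (y', d')"
    then have e: "u d + y = u d' + y'" "v d + y = v d' + y'" by (auto simp: \<phi>_def)
    then have "(u d + y) - (v d + y) = (u d' + y') - (v d' + y')" by simp
    then have "d = d'" using uv *(2,4) by (metis add_diff_cancel_right)
    then show "y = y' \<and> d = d'" using e by simp
  qed
  moreover have "\<phi> ` (Y \<times> (U + uminus ` V)) \<subseteq> (U + Y) \<times> (V + Y)"
    using uv by (auto simp: \<phi>_def)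
  ultimately have "card (Y \<times> (U + uminus ` V)) \<le> card ((U + Y) \<times> (V + Y))"
    using fin by (intro card_inj_on_le) (auto intro!: finite_set_plus)
  then show ?thesis by (simp add: card_cartesian_product)
qed

text \<open>For the subset \<open>X\<close> of \<open>A\<close> minimising
  \<open>|X + A| / |X|\<close>, each further summand \<open>A\<close> costs at most a factor
  \<open>K\<close>. Ruzsa's triangle inequality then passes from \<open>mA + X\<close> and
  \<open>nA + X\<close> to \<open>mA - nA\<close>.\<close>

lemma card_mixsum_le:
  fixes A :: "'a::ab_group_add set" and K :: real
  assumes A: "finite A" "A \<noteq> {}" and K: "K \<ge> 1" "real (card (A + A)) \<le> K * card A"
  shows "real (card (mixsum m n A)) \<le> K ^ (m + n) * card A"
proof -
  define F where "F = {X. X \<subseteq> A \<and> X \<noteq> {}}"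
  define \<rho> where "\<rho> X = real (card (X + A)) / card X" for X
  have "finite F" "F \<noteq> {}" using A by (auto simp: F_def)
  then obtain X where X: "X \<in> F" "\<And>Y. Y \<in> F \<Longrightarrow> \<rho> X \<le> \<rho> Y"
    by (metis arg_min_if_finite(1) arg_min_least)
  define \<kappa> where "\<kappa> = \<rho> X"
  have finX: "finite X" "X \<noteq> {}" "X \<subseteq> A" using X(1) A by (auto simp: F_def finite_subset)
  have cX: "card X > 0" using finX by (simp add: card_gt_0_iff)
  have cA: "card A > 0" using A by (simp add: card_gt_0_iff)
  have k0: "\<kappa> \<ge> 0" by (simp add: \<kappa>_def \<rho>_def)
  have "\<kappa> \<le> \<rho> A" using X A by (auto simp: \<kappa>_def F_def)
  also have "\<dots> \<le> K" using K cA by (simp add: \<rho>_def divide_simps)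
  finally have kK: "\<kappa> \<le> K" .
  have minim: "\<kappa> * real (card Z) \<le> real (card (Z + A))" if "Z \<subseteq> X" for Z
  proof (cases "Z = {}")
    case False
    then have "\<kappa> \<le> \<rho> Z" using that X finX by (auto simp: \<kappa>_def F_def)
    moreover have "card Z > 0" using that False finX by (simp add: card_gt_0_iff finite_subset)
    ultimately show ?thesis by (simp add: \<rho>_def field_simps)
  qed simp
  have it: "real (card (nsum j A + X)) \<le> K ^ j * card X" for j
  proof (induction j)
    case 0
    show ?case by (simp add: card_set_plus_sing)
  next
    case (Suc j)
    have "real (card (nsum j A + (X + A))) \<le> \<kappa> * real (card (nsum j A + X))"
      using finX A k0 minim cX
      by (intro petridis) (auto simp: finite_nsum \<kappa>_def \<rho>_def)
    also have "\<dots> \<le> K * (K ^ j * card X)"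
      using Suc kK k0 by (intro mult_mono) auto
    finally show ?case by (simp add: add_ac mult_ac)
  qed
  have "real (card X) * card (mixsum m n A) \<le> real (card (nsum m A + X)) * card (nsum n A + X)"
    using ruzsa_triangle[of "nsum m A" "nsum n A" X] A finX
    unfolding mixsum_def by (simp add: finite_nsum flip: of_nat_mult)
  also have "\<dots> \<le> (K ^ m * card X) * (K ^ n * card X)"
    using it K by (intro mult_mono) auto
  finally have "real (card (mixsum m n A)) \<le> K ^ (m + n) * card X"
    using cX by (simp add: power_add field_simps)
  also have "\<dots> \<le> K ^ (m + n) * card A"
    using K finX A by (intro mult_left_mono) (auto simp: card_mono)
  finally show ?thesis .
qed

section \<open>A Chernoff bound\<close>

text \<open>For negative \<open>x\<close> it follows from
  \<open>(1 - x) * (1 + x + x\<^sup>2) = 1 - x ^ 3 \<ge> 1\<close> and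
  \<open>1 - x \<le> exp (- x)\<close>.\<close>

lemma exp_le_quadratic:
  fixes x :: real
  assumes "\<bar>x\<bar> \<le> 1"
  shows "exp x \<le> 1 + x + x\<^sup>2"
proof (cases "x \<ge> 0")
  case True
  then show ?thesis using assms by (intro exp_bound) auto
next
  case False
  have "x ^ 3 \<le> 0" using False by (simp add: power_le_zero_eq)
  then have "1 \<le> (1 - x) * (1 + x + x\<^sup>2)"
    by (simp add: algebra_simps power2_eq_square power3_eq_cube)
  also have "\<dots> \<le> exp (- x) * (1 + x + x\<^sup>2)"
  proof (rule mult_right_mono)
    show "1 - x \<le> exp (- x)" using exp_ge_add_one_self[of "- x"] by simp
    show "0 \<le> 1 + x + x\<^sup>2" using False assms by (simp add: abs_if)
  qed
  finally show ?thesis by (simp add: exp_minus field_simps)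
qed

lemma sum_PiE_prod:
  fixes p :: "'k \<Rightarrow> 'c::comm_semiring_1"
  assumes "finite I"
  shows "(\<Sum>s\<in>PiE {..<d} (\<lambda>_. I). \<Prod>j<d. p (s j)) = (sum p I) ^ d"
  using prod_sum_PiE[of "{..<d}" "\<lambda>_. I" "\<lambda>_. p"] assms by simp

text \<open>Weighted sums over \<open>PiE\<close> stand for probabilities of \<open>d\<close>
  independent draws from the distribution \<open>p\<close>. The indicator is bounded by an
  exponential of the excess, whose moment factorises over the draws.\<close>

lemma chernoff_PiE:
  fixes p u :: "'k \<Rightarrow> real"
  assumes I: "finite I" and p: "\<And>i. i \<in> I \<Longrightarrow> p i \<ge> 0" "sum p I = 1"
    and u: "\<And>i. i \<in> I \<Longrightarrow> \<bar>u i\<bar> \<le> 1"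
    and mean: "(\<Sum>i\<in>I. p i * u i) \<le> \<mu>" and \<delta>: "0 \<le> \<delta>" "\<delta> \<le> 4"
  shows "(\<Sum>s\<in>PiE {..<d} (\<lambda>_. I). (\<Prod>j<d. p (s j)) * of_bool (real d * (\<mu> + \<delta>) \<le> (\<Sum>j<d. u (s j))))
    \<le> exp (- (real d * \<delta>\<^sup>2 / 16))"
proof -
  define m where "m = (\<Sum>i\<in>I. p i * u i)"
  \<comment> \<open>This value minimises \<open>- l * \<delta> + 4 * l\<^sup>2\<close>, giving
    \<open>- \<delta>\<^sup>2 / 16\<close>. Since \<open>\<delta> \<le> 4\<close> and deviations
    from the mean are at most \<open>2\<close>, the exponent stays in the range of the quadratic
    bound.\<close>
  define l where "l = \<delta> / 8"
  have "\<bar>m\<bar> \<le> (\<Sum>i\<in>I. p i * 1)"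
    unfolding m_def by (rule order_trans[OF sum_abs], rule sum_mono) (auto simp: abs_mult p(1) u mult_left_le)
  then have m1: "\<bar>m\<bar> \<le> 1" using p by simp
  define e where "e i = exp (l * (u i - \<mu> - \<delta>))" for i
  have "(\<Sum>i\<in>I. p i * exp (l * (u i - m))) \<le> (\<Sum>i\<in>I. p i * (1 + l * (u i - m) + 4 * l\<^sup>2))"
  proof (intro sum_mono mult_left_mono p)
    fix i assume "i \<in> I"
    then have *: "\<bar>u i - m\<bar> \<le> 2" using u[of i] m1 by linarith
    then have "\<bar>l * (u i - m)\<bar> \<le> (1/2) * 2"
      unfolding abs_mult using \<delta> by (intro mult_mono) (auto simp: l_def)
    then have "exp (l * (u i - m)) \<le> 1 + l * (u i - m) + (l * (u i - m))\<^sup>2"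
      by (intro exp_le_quadratic) simp
    moreover have "(u i - m)\<^sup>2 \<le> 2\<^sup>2" using * by (metis abs_le_square_iff abs_numeral)
    then have "l\<^sup>2 * (u i - m)\<^sup>2 \<le> l\<^sup>2 * 4" by (intro mult_left_mono) auto
    then have "(l * (u i - m))\<^sup>2 \<le> 4 * l\<^sup>2"
      by (simp add: power_mult_distrib)
    ultimately show "exp (l * (u i - m)) \<le> 1 + l * (u i - m) + 4 * l\<^sup>2" by simp
  qed
  also have "\<dots> = (\<Sum>i\<in>I. p i * (1 - l * m + 4 * l\<^sup>2) + l * (p i * u i))"
    by (simp add: algebra_simps)
  also have "\<dots> = sum p I * (1 - l * m + 4 * l\<^sup>2) + l * m"
    unfolding m_def by (simp add: sum.distrib flip: sum_distrib_left sum_distrib_right)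
  also have "\<dots> = 1 + 4 * l\<^sup>2" using p by simp
  also have "\<dots> \<le> exp (4 * l\<^sup>2)" by (rule exp_ge_add_one_self)
  finally have 1: "(\<Sum>i\<in>I. p i * exp (l * (u i - m))) \<le> exp (4 * l\<^sup>2)" .
  have "(\<Sum>i\<in>I. p i * e i) = exp (l * (m - \<mu> - \<delta>)) * (\<Sum>i\<in>I. p i * exp (l * (u i - m)))"
    unfolding sum_distrib_left e_def
    by (intro sum.cong) (auto simp: mult.left_commute simp flip: exp_add simp: algebra_simps)
  also have "\<dots> \<le> exp (- l * \<delta>) * exp (4 * l\<^sup>2)"
  proof (rule mult_mono[OF _ 1])
    have "l * (m - \<mu>) \<le> 0" using mean \<delta> by (simp add: l_def m_def mult_nonneg_nonpos)
    then show "exp (l * (m - \<mu> - \<delta>)) \<le> exp (- l * \<delta>)" by (simp add: algebra_simps)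
  qed (auto intro!: sum_nonneg p mult_nonneg_nonneg)
  also have "\<dots> = exp (- (\<delta>\<^sup>2 / 16))"
    by (simp add: l_def power2_eq_square field_simps flip: exp_add)
  finally have E: "(\<Sum>i\<in>I. p i * e i) \<le> exp (- (\<delta>\<^sup>2 / 16))" .
  have "(\<Sum>s\<in>PiE {..<d} (\<lambda>_. I). (\<Prod>j<d. p (s j)) * of_bool (real d * (\<mu> + \<delta>) \<le> (\<Sum>j<d. u (s j))))
      \<le> (\<Sum>s\<in>PiE {..<d} (\<lambda>_. I). \<Prod>j<d. p (s j) * e (s j))"
  proof (rule sum_mono)
    fix s assume s: "s \<in> PiE {..<d} (\<lambda>_. I)"
    then have "\<And>j. j < d \<Longrightarrow> s j \<in> I" by auto
    then have "0 \<le> (\<Prod>j<d. p (s j))" by (intro prod_nonneg) (auto simp: p)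
    moreover have "of_bool (real d * (\<mu> + \<delta>) \<le> (\<Sum>j<d. u (s j))) \<le> (\<Prod>j<d. e (s j))"
    proof -
      have "(\<Prod>j<d. e (s j)) = exp (l * ((\<Sum>j<d. u (s j)) - real d * (\<mu> + \<delta>)))"
        by (simp add: e_def sum_subtractf algebra_simps flip: exp_sum sum_distrib_left)
      moreover have "l \<ge> 0" using \<delta> by (simp add: l_def)
      ultimately show ?thesis by auto
    qed
    ultimately show "(\<Prod>j<d. p (s j)) * of_bool (real d * (\<mu> + \<delta>) \<le> (\<Sum>j<d. u (s j)))
        \<le> (\<Prod>j<d. p (s j) * e (s j))"
      by (simp add: prod.distrib mult_left_mono)
  qed
  also have "\<dots> = (\<Sum>i\<in>I. p i * e i) ^ d" using I by (rule sum_PiE_prod)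
  also have "\<dots> \<le> exp (- (\<delta>\<^sup>2 / 16)) ^ d"
    by (intro power_mono E sum_nonneg) (auto simp: e_def p)
  also have "\<dots> = exp (- (real d * \<delta>\<^sup>2 / 16))"
    by (simp flip: exp_of_nat_mult)
  finally show ?thesis .
qed

section \<open>Chang's covering argument\<close>

text \<open>The subset sums of a list; entries may repeat, so only the length counts as
  dimension.\<close>

primrec cube :: "'a::ab_group_add list \<Rightarrow> 'a set" where
  "cube [] = {0}"
| "cube (s # ss) = {0, s} + cube ss"

lemma card_set_plus_le:
  assumes "finite A" "finite B"
  shows "card (A + B) \<le> card A * card B"
  unfolding set_plus_image using assms
  by (metis card_cartesian_product card_image_le finite_cartesian_product)

lemma card_nsum_pair: "card (nsum n {0, s}) \<le> n + 1"
proof -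
  have "nsum n {0, s} \<subseteq> (\<lambda>i. ((+) s ^^ i) 0) ` {..n}"
  proof (induction n)
    case (Suc n)
    have "0 + ((+) s ^^ i) 0 \<in> (\<lambda>i. ((+) s ^^ i) 0) ` {..Suc n}"
      "s + ((+) s ^^ i) 0 \<in> (\<lambda>i. ((+) s ^^ i) 0) ` {..Suc n}" if "i \<le> n" for i
      using that image_eqI[of _ "\<lambda>i. ((+) s ^^ i) 0" i "{..Suc n}"]
        image_eqI[of _ "\<lambda>i. ((+) s ^^ i) 0" "Suc i" "{..Suc n}"] by auto
    then show ?case using Suc.IH by (fastforce simp: set_plus_def)
  qed auto
  then have "card (nsum n {0, s}) \<le> card {..n}"
    by (rule surj_card_le[rotated]) simp
  then show ?thesis by simp
qed

lemma finite_cube: "finite (cube ss)"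
  by (induction ss) (auto intro!: finite_set_plus)

text \<open>The n-fold sum splits into the progressions \<open>0, s, ..., n s\<close>, one per
  generator. This is the source of polynomial growth in \<open>n\<close>.\<close>

lemma card_nsum_cube: "card (nsum n (cube ss)) \<le> (n + 1) ^ length ss"
proof (induction ss)
  case Nil
  have "nsum n {0} = {0::'a}" by (induction n) (auto simp: set_plus_def)
  then show ?case by simp
next
  case (Cons s ss)
  have "card (nsum n (cube (s # ss))) \<le> card (nsum n {0, s}) * card (nsum n (cube ss))"
    by (simp add: nsum_set_plus card_set_plus_le finite_nsum finite_cube)
  also have "\<dots> \<le> (n + 1) * (n + 1) ^ length ss"
    by (intro mult_mono card_nsum_pair Cons) auto
  finally show ?case by simp
qed

lemma cube_subset_nsum:
  assumes "0 \<in> S" "set ss \<subseteq> S"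
  shows "cube ss \<subseteq> nsum (length ss) S"
  using assms(2)
proof (induction ss)
  case (Cons s ss)
  then show ?case using assms(1) by (simp add: set_plus_mono2)
qed simp

lemma nsum_nsum: "nsum m (nsum n A) = nsum (m * n) A"
  by (induction m) (simp_all add: nsum_add)

text \<open>Disjoint translates by a cube of dimension \<open>r\<close> would put
  \<open>2 ^ r * |X|\<close> points into \<open>(3r + 1)X\<close>, which is excluded. So extension
  fails at some dimension below \<open>r\<close>: there every new generator from \<open>3X\<close>
  makes two translates overlap, and symmetry of \<open>X\<close> turns the resulting
  \<open>X - X\<close> into \<open>2X\<close>.\<close>

lemma chang_covering:
  fixes X :: "'a::ab_group_add set"
  assumes X: "finite X" "0 \<in> X" "uminus ` X = X"
    and small: "card (nsum (3 * r + 1) X) < 2 ^ r * card X"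
  obtains ss where "length ss < r" "nsum 3 X \<subseteq> (cube ss + uminus ` cube ss) + nsum 2 X"
proof -
  \<comment> \<open>\<open>P m\<close>: the \<open>2 ^ m\<close> translates of \<open>X\<close> by the points of some \<open>m\<close>-dimensional cube are disjoint.\<close>
  define P where "P m \<longleftrightarrow> (\<exists>ss. length ss = m \<and> set ss \<subseteq> nsum 3 X \<and> card (cube ss + X) = 2 ^ m * card X)" for m
  have "P 0" by (simp add: P_def card_set_plus_sing)
  have notPr: "\<not> P r"
  proof
    assume "P r"
    then obtain ss where ss: "length ss = r" "set ss \<subseteq> nsum 3 X" "card (cube ss + X) = 2 ^ r * card X"
      by (auto simp: P_def)
    have "0 \<in> nsum 3 X" using X by (auto simp: numeral_3_eq_3 set_plus_def) (metis add.right_neutral)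
    then have "cube ss \<subseteq> nsum r (nsum 3 X)" using cube_subset_nsum ss by blast
    then have "cube ss + X \<subseteq> nsum (3 * r) X + nsum 1 X"
      by (simp add: nsum_nsum mult.commute set_plus_mono2)
    then have "card (cube ss + X) \<le> card (nsum (3 * r + 1) X)"
      using X unfolding nsum_add by (intro card_mono) (auto intro!: finite_set_plus finite_nsum)
    with ss small show False by simp
  qed
  have "\<exists>m<r. P m \<and> \<not> P (Suc m)"
  proof (rule ccontr)
    assume *: "\<not> (\<exists>m<r. P m \<and> \<not> P (Suc m))"
    have "m \<le> r \<Longrightarrow> P m" for m
      by (induction m) (use \<open>P 0\<close> * in \<open>auto simp: less_eq_Suc_le\<close>)
    with notPr show False by blast
  qed
  then obtain m ss where m: "m < r" "\<not> P (Suc m)" and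
    ss: "length ss = m" "set ss \<subseteq> nsum 3 X" "card (cube ss + X) = 2 ^ m * card X"
    by (auto simp: P_def)
  have "x \<in> (cube ss + uminus ` cube ss) + nsum 2 X" if x: "x \<in> nsum 3 X" for x
  proof -
    define Q where "Q = cube ss + X"
    have finQ: "finite Q" using X by (auto simp: Q_def finite_cube intro!: finite_set_plus)
    have eq: "cube (x # ss) + X = Q \<union> ({x} + Q)"
      using Un_set_plus[of "{x}" "{0}" Q] by (auto simp: Q_def add.assoc insert_commute)
    have "Q \<inter> ({x} + Q) \<noteq> {}"
    proof
      assume "Q \<inter> ({x} + Q) = {}"
      then have "card (cube (x # ss) + X) = card Q + card Q"
        unfolding eq using finQ by (subst card_Un_disjoint) (simp_all add: card_set_plus_sing finite_set_plus)
      then have "P (Suc m)"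
        unfolding P_def using ss x by (intro exI[of _ "x # ss"]) (auto simp: Q_def)
      with m show False by simp
    qed
    then obtain q y q' y' where *: "q \<in> cube ss" "y \<in> X" "q' \<in> cube ss" "y' \<in> X" "q + y = x + (q' + y')"
      by (auto simp: Q_def set_plus_def)
    have "x = (q + - q') + (y + - y')"
      using *(5) by (simp add: algebra_simps)
    moreover have "- y' \<in> X" using * X by blast
    ultimately have "x \<in> (cube ss + uminus ` cube ss) + (X + X)"
      using * by (metis imageI set_plus_intro)
    then show ?thesis by (simp add: numeral_2_eq_2)
  qed
  then show ?thesis using that m ss by blast
qed

text \<open>The cover replaces \<open>X + 2X = 3X\<close> by \<open>P + 2X\<close>. Each further
  summand \<open>X\<close> is thus traded for one summand \<open>P\<close> of bounded dimension,
  while the remainder stays \<open>2X\<close>.\<close>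

lemma card_nsum_le_of_covering:
  fixes X :: "'a::ab_group_add set"
  assumes X: "finite X" "0 \<in> X"
    and cover: "nsum 3 X \<subseteq> (cube ss + uminus ` cube ss) + nsum 2 X"
  shows "card (nsum n X) \<le> (n + 1) ^ (2 * length ss) * card (nsum 2 X)"
proof -
  define P where "P = cube ss + uminus ` cube ss"
  have "nsum n X \<subseteq> nsum n P + nsum 2 X"
  proof (induction n)
    case 0
    have "0 \<in> nsum 2 X" using X by (auto simp: numeral_2_eq_2 set_plus_def) (metis add.right_neutral)
    then show ?case by (auto simp: set_plus_def)
  next
    case (Suc n)
    have "nsum (Suc n) X \<subseteq> X + (nsum n P + nsum 2 X)"
      using Suc by (simp add: set_plus_mono2)
    also have "\<dots> = nsum n P + nsum 3 X"
      by (simp add: numeral_3_eq_3 numeral_2_eq_2 add_ac)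
    also have "\<dots> \<subseteq> nsum n P + (P + nsum 2 X)"
      using cover unfolding P_def by (intro set_plus_mono2) auto
    also have "\<dots> = nsum (Suc n) P + nsum 2 X" by (simp add: add_ac)
    finally show ?case .
  qed
  then have "card (nsum n X) \<le> card (nsum n P + nsum 2 X)"
    using X by (intro card_mono) (auto simp: P_def finite_cube intro!: finite_set_plus finite_nsum)
  also have "\<dots> \<le> card (nsum n P) * card (nsum 2 X)"
    using X by (intro card_set_plus_le) (auto simp: P_def finite_cube intro!: finite_set_plus finite_nsum)
  also have "card (nsum n P) \<le> (n + 1) ^ length ss * (n + 1) ^ length ss"
  proof -
    have "card (nsum n P) \<le> card (nsum n (cube ss)) * card (nsum n (uminus ` cube ss))"
      unfolding P_def nsum_set_plus by (intro card_set_plus_le finite_nsum finite_imageI finite_cube)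
    also have "card (nsum n (uminus ` cube ss)) = card (nsum n (cube ss))"
      by (simp add: nsum_uminus card_image)
    also have "card (nsum n (cube ss)) * card (nsum n (cube ss)) \<le> (n + 1) ^ length ss * (n + 1) ^ length ss"
      by (intro mult_mono card_nsum_cube) auto
    finally show ?thesis .
  qed
  finally show ?thesis by (simp add: power_add mult_2)
qed

section \<open>Almost periods\<close>

text \<open>Averages of the indicator of \<open>A + A\<close> over \<open>l\<close> random
  translates approximate \<open>f\<close> off a small set. A good sample shifted by \<open>t\<close>
  is a tuple in \<open>A + A\<close>, so by pigeonhole many \<open>t\<close> share one shifted
  sample \<open>b\<close>, and the corresponding shifts of \<open>f\<close> all resemble one
  function. A level of \<open>f\<close> with few points just below it converts this into near
  invariance of a set.\<close>

lemma croot_sisask: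
  fixes A :: "'a::ab_group_add set" and K :: real
  assumes A: "finite A" "A \<noteq> {}" and K: "K \<ge> 1" "real (card (A + A)) \<le> K * card A"
    and n: "n \<ge> 1" "(65 / 64) ^ n > 2 * K"
    and l: "l \<ge> 1" "2 * K ^ 3 * exp (- (real l * (1 / (4 * real n))\<^sup>2 / 16)) \<le> 1 / 512"
  obtains B T where "B \<subseteq> mixsum 2 1 A" "card A \<le> card B" "T \<subseteq> A" "real (card A) \<le> 2 * K ^ l * card T"
    "\<And>t t'. t \<in> T \<Longrightarrow> t' \<in> T \<Longrightarrow> real (card {x\<in>B. x + (t - t') \<notin> B}) \<le> card B / 32"
proof -
  define S where "S = A + A"
  define D where "D = mixsum 2 1 A"
  define f where "f x = (\<Sum>a\<in>A. (1 / card A) * of_bool (x + a \<in> S) :: real)" for x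
  define F where "F c x = (\<Sum>j<l. of_bool (x + c j \<in> S) :: real)" for c :: "nat \<Rightarrow> 'a" and x
  \<comment> \<open>With this choice \<open>n\<close> steps of height \<open>2 * \<delta>\<close>
    descend from level \<open>1\<close> to level \<open>1 / 2\<close>.\<close>
  define \<delta> where "\<delta> = 1 / (4 * real n)"
  define bad where "bad c = {x\<in>D. real l * \<delta> \<le> \<bar>F c x - real l * f x\<bar>}" for c
  define \<Omega> where "\<Omega> = PiE {..<l} (\<lambda>_. A)"
  define \<G> where "\<G> = {c\<in>\<Omega>. real (card (bad c)) \<le> card A / 256}"
  have cA: "card A > 0" using A by (simp add: card_gt_0_iff)
  have fin: "finite S" "finite D" "finite \<Omega>" "finite \<G>" "\<And>c. finite (bad c)"
    using A by (auto simp: S_def D_def \<Omega>_def \<G>_def bad_def finite_mixsum intro!: finite_set_plus finite_PiE)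
  have \<delta>: "\<delta> > 0" "\<delta> \<le> 4" "2 * \<delta> * n = 1 / 2"
    using n by (auto simp: \<delta>_def field_simps)
  have D: "D = S + uminus ` A"
    by (simp add: D_def mixsum_def S_def numeral_2_eq_2)
  have inD: "x \<in> D" if "a \<in> A" "x + a \<in> S" for x a
  proof -
    have "(x + a) + - a \<in> S + uminus ` A" using that by blast
    then show ?thesis by (simp add: D)
  qed
  have AD: "A \<subseteq> D"
    using mixsum_subset_mixsum[OF A(2), of 1 0 1] by (simp add: D_def numeral_2_eq_2)
  have f0: "f x = 0" if "x \<notin> D" for x
    using that inD unfolding f_def by (intro sum.neutral) auto
  have f1: "f x = 1" if "x \<in> A" for x
  proof -
    have "f x = (\<Sum>a\<in>A. 1 / card A)"
      unfolding f_def using that by (intro sum.cong) (auto simp: S_def)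
    then show ?thesis using cA by simp
  qed
  have F0: "F c x = 0" if "x \<notin> D" "\<And>j. j < l \<Longrightarrow> c j \<in> A" for c x
    using that inD unfolding F_def by (intro sum.neutral) auto

  have count_bad: "real (card {c\<in>\<Omega>. x \<in> bad c}) \<le> card \<Omega> * (2 * exp (- (real l * \<delta>\<^sup>2 / 16)))" for x
  proof -
    let ?u = "\<lambda>a. of_bool (x + a \<in> S) :: real"
    let ?p = "\<lambda>a::'a. 1 / real (card A)"
    let ?E1 = "\<lambda>s. real l * (f x + \<delta>) \<le> (\<Sum>j<l. ?u (s j))"
    let ?E2 = "\<lambda>s. real l * (- f x + \<delta>) \<le> (\<Sum>j<l. - ?u (s j))"
    have 1: "(\<Sum>s\<in>\<Omega>. (\<Prod>j<l. ?p (s j)) * of_bool (?E1 s)) \<le> exp (- (real l * \<delta>\<^sup>2 / 16))"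
      unfolding \<Omega>_def using \<delta> A cA by (intro chernoff_PiE) (auto simp: f_def)
    have 2: "(\<Sum>s\<in>\<Omega>. (\<Prod>j<l. ?p (s j)) * of_bool (?E2 s)) \<le> exp (- (real l * \<delta>\<^sup>2 / 16))"
      unfolding \<Omega>_def using \<delta> A cA by (intro chernoff_PiE) (auto simp: f_def sum_negf)
    have cO: "real (card \<Omega>) = card A ^ l" by (simp add: \<Omega>_def card_PiE)
    have "real (card {c\<in>\<Omega>. x \<in> bad c}) = (\<Sum>c\<in>\<Omega>. of_bool (x \<in> bad c))"
      using fin by (simp add: Int_def)
    also have "\<dots> \<le> (\<Sum>c\<in>\<Omega>. of_bool (?E1 c) + of_bool (?E2 c))"
      by (intro sum_mono) (auto simp: bad_def F_def abs_if sum_negf algebra_simps split: if_splits)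
    also have "\<dots> = card \<Omega> * (\<Sum>c\<in>\<Omega>. (\<Prod>j<l. ?p (c j)) * of_bool (?E1 c) + (\<Prod>j<l. ?p (c j)) * of_bool (?E2 c))"
      unfolding sum_distrib_left cO using cA by (intro sum.cong) (auto simp: power_divide)
    also have "\<dots> \<le> card \<Omega> * (2 * exp (- (real l * \<delta>\<^sup>2 / 16)))"
      unfolding sum.distrib using 1 2 by (intro mult_left_mono) auto
    finally show ?thesis .
  qed

  have "(\<Sum>c\<in>\<Omega>. real (card (bad c))) = (\<Sum>c\<in>\<Omega>. \<Sum>x\<in>D. of_bool (x \<in> bad c))"
    using fin by (intro sum.cong) (auto simp: bad_def Int_def intro!: arg_cong[where f = card])
  also have "\<dots> = (\<Sum>x\<in>D. real (card {c\<in>\<Omega>. x \<in> bad c}))"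
    using fin by (subst sum.swap) (simp add: Int_def)
  also have "\<dots> \<le> (\<Sum>x\<in>D. card \<Omega> * (2 * exp (- (real l * \<delta>\<^sup>2 / 16))))"
    by (intro sum_mono count_bad)
  also have "\<dots> = card D * (card \<Omega> * (2 * exp (- (real l * \<delta>\<^sup>2 / 16))))" by simp
  also have "\<dots> \<le> (K ^ 3 * card A) * (card \<Omega> * (2 * exp (- (real l * \<delta>\<^sup>2 / 16))))"
    using card_mixsum_le[OF A K, of 2 1] by (intro mult_right_mono) (auto simp: D_def)
  also have "\<dots> = card A * card \<Omega> * (2 * K ^ 3 * exp (- (real l * \<delta>\<^sup>2 / 16)))" by simp
  also have "\<dots> \<le> card A * card \<Omega> * (1 / 512)"
    using l by (intro mult_left_mono) (auto simp: \<delta>_def)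
  finally have tot: "(\<Sum>c\<in>\<Omega>. real (card (bad c))) \<le> card A * card \<Omega> / 512" by simp
  \<comment> \<open>Markov's inequality: \<open>|bad c|\<close> averages at most
    \<open>|A| / 512\<close>, so at most half of the samples exceed
    \<open>|A| / 256\<close>.\<close>
  have "card (\<Omega> - \<G>) * (card A / 256) \<le> (\<Sum>c\<in>\<Omega> - \<G>. real (card (bad c)))"
    by (rule sum_bounded_below) (auto simp: \<G>_def)
  also have "\<dots> \<le> (\<Sum>c\<in>\<Omega>. real (card (bad c)))" using fin by (intro sum_mono2) auto
  finally have "real (card (\<Omega> - \<G>)) * (card A / 256) \<le> card A * card \<Omega> / 512" using tot by linarith
  then have "real (card (\<Omega> - \<G>)) \<le> card \<Omega> / 2" using cA by (simp add: field_simps)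
  moreover have "card (\<Omega> - \<G>) = card \<Omega> - card \<G>" "card \<G> \<le> card \<Omega>"
    using fin by (auto simp: \<G>_def card_Diff_subset intro!: card_mono)
  ultimately have G: "real (card \<G>) \<ge> real (card A) ^ l / 2"
    by (simp add: \<Omega>_def card_PiE of_nat_diff)

  define \<Phi> where "\<Phi> = (\<lambda>(c, t). \<lambda>j\<in>{..<l}. c j + t :: 'a)"
  \<comment> \<open>At least \<open>|A| ^ (l + 1) / 2\<close> pairs \<open>(c, t)\<close> meet at
    most \<open>(K * |A|) ^ l\<close> possible images. A fibre is parametrised by \<open>t\<close>
    alone, since \<open>c\<close> is \<open>b\<close> shifted by \<open>- t\<close>.\<close>
  have "\<exists>b\<in>PiE {..<l} (\<lambda>_. S). card (\<Phi> -` {b} \<inter> (\<G> \<times> A)) * card (PiE {..<l} (\<lambda>_. S)) \<ge> card (\<G> \<times> A)"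
  proof (rule pigeonhole_card)
    show "\<Phi> \<in> \<G> \<times> A \<rightarrow> PiE {..<l} (\<lambda>_. S)"
      by (fastforce simp: \<Phi>_def \<G>_def \<Omega>_def S_def)
    have "S \<noteq> {}" using A by (auto simp: S_def set_plus_def)
    then show "PiE {..<l} (\<lambda>_. S) \<noteq> {}" by (auto simp: PiE_eq_empty_iff)
  qed (use fin A in \<open>auto intro!: finite_PiE\<close>)
  then obtain b where b: "b \<in> PiE {..<l} (\<lambda>_. S)"
    "card (\<G> \<times> A) \<le> card (\<Phi> -` {b} \<inter> (\<G> \<times> A)) * card (PiE {..<l} (\<lambda>_. S))" by blast
  \<comment> \<open>For \<open>t \<in> T\<close> the sampled average along \<open>b - t\<close> is the one along \<open>b\<close> shifted by \<open>t\<close>, and it is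
    close to \<open>f\<close>; so \<open>f\<close> is nearly invariant under \<open>T - T\<close>.\<close>
  define c where "c t = (\<lambda>j\<in>{..<l}. b j - t)" for t
  define T where "T = {t\<in>A. c t \<in> \<G>}"
  have c_eq: "s = c t" if "s \<in> \<G>" "\<Phi> (s, t) = b" for s t
  proof
    fix j
    show "s j = c t j"
    proof (cases "j < l")
      case True
      then show ?thesis using that by (auto simp: \<Phi>_def c_def)
    next
      case False
      then show ?thesis using that by (auto simp: c_def \<G>_def \<Omega>_def)
    qed
  qed
  have "card (\<Phi> -` {b} \<inter> (\<G> \<times> A)) \<le> card T"
  proof (rule card_inj_on_le[where f = snd])
    show "inj_on snd (\<Phi> -` {b} \<inter> (\<G> \<times> A))"
    proof (rule inj_onI)
      fix x y assume xy: "x \<in> \<Phi> -` {b} \<inter> (\<G> \<times> A)" "y \<in> \<Phi> -` {b} \<inter> (\<G> \<times> A)" "snd x = snd y"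
      then have "fst x = c (snd x)" "fst y = c (snd y)"
        using c_eq[of "fst x" "snd x"] c_eq[of "fst y" "snd y"] by auto
      then show "x = y" using xy by (simp add: prod_eq_iff)
    qed
    show "snd ` (\<Phi> -` {b} \<inter> (\<G> \<times> A)) \<subseteq> T"
      using c_eq by (force simp: T_def)
  qed (use A in \<open>simp add: T_def\<close>)
  then have "card \<G> * card A \<le> card T * card S ^ l"
    using b(2) by (simp add: card_cartesian_product card_PiE)
      (meson le_trans mult_le_mono1)
  then have "real (card \<G>) * card A \<le> card T * real (card S) ^ l"
    by (metis of_nat_le_iff of_nat_mult of_nat_power)
  also have "\<dots> \<le> card T * (K * card A) ^ l"
    using K by (intro mult_left_mono power_mono) (auto simp: S_def)
  finally have "real (card A) ^ l / 2 * card A \<le> card T * (K * card A) ^ l"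
    using G by (meson mult_right_mono of_nat_0_le_iff order_trans)
  then have cT: "real (card A) \<le> 2 * K ^ l * card T"
    using cA by (simp add: power_mult_distrib field_simps)

  \<comment> \<open>The sizes start at \<open>|A|\<close> or more. On \<open>L n\<close> the
    function is at least \<open>1 / 2\<close> while its sum is at most \<open>|A + A|\<close>, so
    \<open>|L n| \<le> 2 * K * |A|\<close>; growth by \<open>65 / 64\<close> at all \<open>n\<close>
    steps is impossible.\<close>
  define L where "L i = {x\<in>D. 1 - 2 * \<delta> * real i \<le> f x}" for i
  have "\<exists>i<n. real (card (L (Suc i))) \<le> 65 / 64 * card (L i)"
  proof (rule ccontr)
    assume *: "\<not> ?thesis"
    have "(65 / 64) ^ i * card A \<le> real (card (L i))" if "i \<le> n" for i
      using that
    proof (induction i)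
      case 0
      have "A \<subseteq> L 0" using AD f1 by (auto simp: L_def)
      then show ?case using fin by (auto simp: L_def intro!: card_mono)
    next
      case (Suc i)
      have "(65 / 64) ^ Suc i * card A \<le> 65 / 64 * real (card (L i))"
        using Suc by (simp add: mult.commute)
      also have "\<dots> \<le> card (L (Suc i))" using * Suc.prems by (simp add: not_le less_imp_le)
      finally show ?case .
    qed
    moreover have "real (card (L n)) * (1 / 2) \<le> K * card A"
    proof -
      have "real (card (L n)) * (1 / 2) \<le> (\<Sum>x\<in>L n. f x)"
        by (rule sum_bounded_below) (use \<delta>(3) in \<open>auto simp: L_def\<close>)
      also have "\<dots> = (\<Sum>a\<in>A. (1 / card A) * (\<Sum>x\<in>L n. of_bool (x + a \<in> S)))"
        unfolding f_def sum_distrib_left by (rule sum.swap)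
      also have "\<dots> \<le> (\<Sum>a\<in>A. (1 / card A) * card S)"
      proof (intro sum_mono mult_left_mono)
        fix a
        have "card {x\<in>L n. x + a \<in> S} \<le> card S"
          by (rule card_inj_on_le[where f = "\<lambda>x. x + a"]) (use fin in auto)
        then show "(\<Sum>x\<in>L n. of_bool (x + a \<in> S)) \<le> real (card S)"
          using fin by (simp add: L_def Int_def)
      qed auto
      also have "\<dots> = card S" using cA by simp
      finally show ?thesis using K by (simp add: S_def)
    qed
    ultimately have "(65 / 64) ^ n * real (card A) \<le> 2 * K * card A" by fastforce
    then show False using n cA by simp
  qed
  then obtain i where i: "i < n" "real (card (L (Suc i))) \<le> 65 / 64 * card (L i)" by blast
  define B where "B = L i"
  have finL: "finite (L i)" for i using fin by (simp add: L_def)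
  have AB: "A \<subseteq> B" using AD f1 \<delta> by (auto simp: B_def L_def)
  then have cAB: "card A \<le> card B" using finL by (simp add: card_mono B_def)
  have "B \<subseteq> L (Suc i)" using \<delta> by (auto simp: B_def L_def algebra_simps)
  then have "card (L (Suc i) - B) = card (L (Suc i)) - card B" "card B \<le> card (L (Suc i))"
    using finL by (auto simp: B_def intro!: card_mono card_Diff_subset)
  then have cL: "real (card (L (Suc i) - B)) \<le> card B / 64"
    using i by (simp add: B_def of_nat_diff)
  \<comment> \<open>\<open>bad\<close> records only points of \<open>D\<close>; outside
    \<open>D\<close> both \<open>f\<close> and the sampled sum vanish.\<close>
  have approx: "\<bar>F b (x - t) - real l * f x\<bar> < real l * \<delta>" if "t \<in> T" "x \<notin> bad (c t)" for t x
  proof (cases "x \<in> D")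
    case True
    have "F (c t) x = F b (x - t)"
      unfolding F_def by (intro sum.cong) (auto simp: c_def algebra_simps)
    then show ?thesis using that True by (auto simp: bad_def)
  next
    case False
    have "F (c t) x = F b (x - t)"
      unfolding F_def by (intro sum.cong) (auto simp: c_def algebra_simps)
    moreover have "F (c t) x = 0"
      using that False by (intro F0) (auto simp: T_def \<G>_def \<Omega>_def)
    ultimately show ?thesis using f0[OF False] l \<delta> by simp
  qed
  have "real (card {x\<in>B. x + (t - t') \<notin> B}) \<le> card B / 32" if t: "t \<in> T" "t' \<in> T" for t t'
  proof -
    \<comment> \<open>A point lost under the shift is bad for \<open>t'\<close>, or its image is bad
      for \<open>t\<close> or falls into the thin layer just below the level of \<open>B\<close>.
      The budget is \<open>1/256 + 1/256 + 1/64 < 1/32\<close>.\<close>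
    let ?M = "bad (c t) \<union> (L (Suc i) - B)"
    have "{x\<in>B. x + (t - t') \<notin> B} \<subseteq> bad (c t') \<union> (\<lambda>y. y - (t - t')) ` ?M"
    proof
      fix x assume x: "x \<in> {x\<in>B. x + (t - t') \<notin> B}"
      define y where "y = x + (t - t')"
      have "y \<in> ?M" if nb: "x \<notin> bad (c t')"
      proof (rule ccontr)
        assume *: "y \<notin> ?M"
        have "y - t = x - t'" by (simp add: y_def)
        then have "\<bar>real l * f x - real l * f y\<bar> < 2 * (real l * \<delta>)"
          using approx[OF t(2) nb] approx[OF t(1), of y] * by auto
        then have "real l * (f x - 2 * \<delta>) < real l * f y"
          by (simp add: algebra_simps)
        then have fy: "f x - 2 * \<delta> < f y" using l by simp
        moreover have "1 - 2 * \<delta> * i \<le> f x" using x by (auto simp: B_def L_def)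
        ultimately have fy: "1 - 2 * \<delta> * Suc i \<le> f y" by (simp add: algebra_simps)
        have "2 * \<delta> * real (Suc i) \<le> 2 * \<delta> * n"
          using i \<delta> by (intro mult_left_mono) auto
        then have "f y > 0" using fy \<delta> by linarith
        then have "y \<in> D" using f0 by fastforce
        then have "y \<in> L (Suc i)" using fy by (simp add: L_def)
        then show False using * x by (auto simp: y_def)
      qed
      moreover have "x = y - (t - t')" by (simp add: y_def)
      ultimately show "x \<in> bad (c t') \<union> (\<lambda>y. y - (t - t')) ` ?M" by blast
    qed
    then have "card {x\<in>B. x + (t - t') \<notin> B} \<le> card (bad (c t') \<union> (\<lambda>y. y - (t - t')) ` ?M)"
      using fin finL by (intro card_mono) auto
    also have "\<dots> \<le> card (bad (c t')) + card ?M"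
      using fin finL by (intro order_trans[OF card_Un_le] add_left_mono card_image_le) auto
    also have "card ?M \<le> card (bad (c t)) + card (L (Suc i) - B)" by (rule card_Un_le)
    finally have "real (card {x\<in>B. x + (t - t') \<notin> B})
        \<le> card (bad (c t')) + (card (bad (c t)) + card (L (Suc i) - B))"
      by (simp add: algebra_simps flip: of_nat_add)
    moreover have "card (bad (c t)) \<le> card A / 256" "card (bad (c t')) \<le> card A / 256"
      using t by (auto simp: T_def \<G>_def)
    moreover have "real (card A) \<le> card B" using cAB by simp
    ultimately show ?thesis using cL by linarith
  qed
  then show ?thesis
    using that[of B T] cT cAB by (auto simp: B_def L_def D_def T_def)
qed

section \<open>Sampling characters\<close>

definition character :: "('a::ab_group_add \<Rightarrow> complex) \<Rightarrow> bool" where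
  "character \<chi> \<longleftrightarrow> (\<forall>x y. \<chi> (x + y) = \<chi> x * \<chi> y) \<and> (\<forall>x. cmod (\<chi> x) = 1)"

lemma character_add: "character \<chi> \<Longrightarrow> \<chi> (x + y) = \<chi> x * \<chi> y"
  and cmod_character [simp]: "character \<chi> \<Longrightarrow> cmod (\<chi> x) = 1"
  by (auto simp: character_def)

lemma character_0: 
  assumes "character \<chi>" 
  shows "\<chi> 0 = 1"
proof -
  have "\<chi> 0 * \<chi> 0 = \<chi> 0 * 1" using character_add[OF assms, of 0 0] by simp
  moreover have "\<chi> 0 \<noteq> 0" using cmod_character[OF assms, of 0] by force
  ultimately show ?thesis by (metis mult_left_cancel)
qed

lemma character_uminus:
  assumes "character \<chi>"
  shows "\<chi> (- x) = cnj (\<chi> x)"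
proof -
  have "\<chi> x * \<chi> (- x) = 1"
    using character_add[OF assms, of x "- x"] character_0[OF assms] by simp
  moreover have "\<chi> x * cnj (\<chi> x) = 1"
    using cmod_character[OF assms, of x] by (simp add: complex_norm_square[symmetric])
  ultimately show ?thesis
    by (metis mult_left_cancel mult_zero_left zero_neq_one)
qed

lemma character_diff: "character \<chi> \<Longrightarrow> \<chi> (x - y) = \<chi> x * cnj (\<chi> y)"
  using character_add[of \<chi> x "- y"] by (simp add: character_uminus)

lemma abs_Re_character: "character \<chi> \<Longrightarrow> \<bar>Re (\<chi> x)\<bar> \<le> 1"
  by (metis abs_Re_le_cmod cmod_character)

text \<open>Expanding the squared modulus produces \<open>\<chi> i (x + b - b')\<close>, and
  orthogonality selects \<open>b' = x + b\<close>. It is required only at the arguments that occur,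
  so a finite family replaces the dual group. At \<open>x = 0\<close> the identity says that the
  weights sum to \<open>1\<close>.\<close>

lemma autocorrelation_eq_average:
  fixes \<chi> :: "'k \<Rightarrow> 'a::ab_group_add \<Rightarrow> complex"
  assumes B: "finite B" "B \<noteq> {}" and I: "finite I" "I \<noteq> {}"
    and \<chi>: "\<And>i. i \<in> I \<Longrightarrow> character (\<chi> i)"
    and orth: "\<And>b b'. b \<in> B \<Longrightarrow> b' \<in> B \<Longrightarrow>
      (\<Sum>i\<in>I. \<chi> i (x + b - b')) = of_nat (card I) * of_bool (x + b - b' = 0)"
  shows "(\<Sum>i\<in>I. (cmod (\<Sum>b\<in>B. \<chi> i b))\<^sup>2 / (card B * card I) * Re (\<chi> i x))
    = card {b\<in>B. b + x \<in> B} / card B"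
proof -
  have cB: "card B > 0" "card I > 0" using B I by (simp_all add: card_gt_0_iff)
  have "(\<Sum>i\<in>I. complex_of_real ((cmod (\<Sum>b\<in>B. \<chi> i b))\<^sup>2 / (card B * card I)) * \<chi> i x)
      = (\<Sum>i\<in>I. (1 / (of_nat (card B) * of_nat (card I))) * (\<Sum>b\<in>B. \<Sum>b'\<in>B. \<chi> i (x + b - b')))"
  proof (rule sum.cong[OF refl])
    fix i assume i: "i \<in> I"
    have "complex_of_real ((cmod (\<Sum>b\<in>B. \<chi> i b))\<^sup>2) = (\<Sum>b\<in>B. \<chi> i b) * (\<Sum>b'\<in>B. cnj (\<chi> i b'))"
      by (simp only: complex_norm_square cnj_sum)
    also have "\<dots> * \<chi> i x = (\<Sum>b\<in>B. \<Sum>b'\<in>B. \<chi> i (x + b - b'))"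
      unfolding sum_product sum_distrib_right
      by (intro sum.cong refl) (simp add: character_diff[OF \<chi>[OF i]] character_add[OF \<chi>[OF i]] sum_distrib_left mult_ac)
    finally show "complex_of_real ((cmod (\<Sum>b\<in>B. \<chi> i b))\<^sup>2 / (card B * card I)) * \<chi> i x
      = (1 / (of_nat (card B) * of_nat (card I))) * (\<Sum>b\<in>B. \<Sum>b'\<in>B. \<chi> i (x + b - b'))"
      by simp
  qed
  also have "\<dots> = (1 / (of_nat (card B) * of_nat (card I))) * (\<Sum>b\<in>B. \<Sum>b'\<in>B. \<Sum>i\<in>I. \<chi> i (x + b - b'))"
    unfolding sum_distrib_left[symmetric] by (simp add: sum.swap[of _ _ I])
  also have "\<dots> = (1 / (of_nat (card B) * of_nat (card I))) * (\<Sum>b\<in>B. \<Sum>b'\<in>B. of_nat (card I) * of_bool (x + b - b' = 0))"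
    by (simp add: orth)
  also have "\<dots> = (1 / of_nat (card B)) * (\<Sum>b\<in>B. \<Sum>b'\<in>B. of_bool (x + b - b' = 0))"
    using cB by (simp flip: sum_distrib_left)
  also have "(\<Sum>b\<in>B. \<Sum>b'\<in>B. of_bool (x + b - b' = 0)) = (\<Sum>b\<in>B. of_bool (b + x \<in> B) :: complex)"
  proof (rule sum.cong[OF refl])
    fix b
    have "(\<Sum>b'\<in>B. of_bool (x + b - b' = 0)) = (\<Sum>b'\<in>B. if b' = b + x then 1 else 0 :: complex)"
      by (intro sum.cong) (auto simp: add.commute)
    then show "(\<Sum>b'\<in>B. of_bool (x + b - b' = 0)) = (of_bool (b + x \<in> B) :: complex)"
      using B by simp
  qed
  also have "\<dots> = of_nat (card {b\<in>B. b + x \<in> B})"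
    using B by (simp add: Int_def)
  finally have "Re (\<Sum>i\<in>I. complex_of_real ((cmod (\<Sum>b\<in>B. \<chi> i b))\<^sup>2 / (card B * card I)) * \<chi> i x)
    = Re (complex_of_real (card {b\<in>B. b + x \<in> B} / card B))"
    by simp
  then show ?thesis by (simp only: Re_sum Re_complex_of_real times_complex.simps) simp
qed

text \<open>The characters \<open>\<chi> (s j)\<close> are drawn independently with probabilities proportional to the squared
  Fourier coefficients of \<open>B\<close>. Event \<open>E1\<close> says that the sample average is not close to \<open>1\<close> on
  \<open>T - T\<close>, and \<open>E2 x\<close> that it is not small at \<open>x\<close>.\<close>

lemma sample_characters:
  fixes B T W :: "'a::ab_group_add set" and \<chi> :: "'k \<Rightarrow> 'a \<Rightarrow> complex"
  assumes B: "finite B" "B \<noteq> {}" and T: "finite T" "T \<noteq> {}" and W: "finite W"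
    and shift: "\<And>t t'. t \<in> T \<Longrightarrow> t' \<in> T \<Longrightarrow> real (card {x\<in>B. x + (t - t') \<notin> B}) \<le> card B / 32"
    and I: "finite I" "I \<noteq> {}" and \<chi>: "\<And>i. i \<in> I \<Longrightarrow> character (\<chi> i)"
    and orth: "\<And>x b b'. x \<in> (W + (T + uminus ` T)) \<union> (T + uminus ` T) \<Longrightarrow> b \<in> B \<Longrightarrow> b' \<in> B \<Longrightarrow>
      (\<Sum>i\<in>I. \<chi> i (x + b - b')) = of_nat (card I) * of_bool (x + b - b' = 0)"
    and d: "1 + 4 * real (card (W + (T + uminus ` T))) / card T < exp (real d / 256)"
  obtains s where "\<And>j. j < d \<Longrightarrow> s j \<in> I"
    "\<And>x. x \<in> W \<Longrightarrow> (\<And>j. j < d \<Longrightarrow> cmod (\<chi> (s j) x - 1) \<le> 1 / 10) \<Longrightarrow> x \<in> B + uminus ` B"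
proof -
  define V where "V = W + (T + uminus ` T)"
  define p where "p i = (cmod (\<Sum>b\<in>B. \<chi> i b))\<^sup>2 / (card B * card I)" for i
  define g where "g x = real (card {b\<in>B. b + x \<in> B}) / card B" for x
  define \<Omega> where "\<Omega> = PiE {..<d} (\<lambda>_. I)"
  define w where "w s = (\<Prod>j<d. p (s j))" for s :: "nat \<Rightarrow> 'k"
  \<comment> \<open>The minus sign turns a sample average that is too small on \<open>T - T\<close>
    into a large sum, the tail that the Chernoff bound controls.\<close>
  define u where "u i = (\<Sum>t'\<in>T. \<Sum>t\<in>T. - Re (\<chi> i (t - t')) / (card T)\<^sup>2)" for i
  \<comment> \<open>Both events are deviations by at least \<open>1/4\<close>: from a mean of at
    least \<open>31/32\<close> on \<open>T - T\<close> down to \<open>23/32\<close>, and, for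
    \<open>x\<close> in \<open>Z\<close>, from a mean of at most \<open>1/32\<close> up to
    \<open>9/32\<close>.\<close>
  define E1 where "E1 s \<longleftrightarrow> real d * (- (31 / 32) + 1 / 4) \<le> (\<Sum>j<d. u (s j))" for s
  define E2 where "E2 x s \<longleftrightarrow> real d * (1 / 32 + 1 / 4) \<le> (\<Sum>j<d. Re (\<chi> (s j) x))" for x s
  define Z where "Z = {x\<in>V. g x \<le> 1 / 32}"
  have cB: "card B > 0" "card I > 0" "card T > 0" using B I T by (simp_all add: card_gt_0_iff)
  have finV: "finite V" using W T by (simp add: V_def finite_set_plus)
  then have finZ: "finite Z" by (simp add: Z_def)
  have fin\<Omega>: "finite \<Omega>" using I by (auto simp: \<Omega>_def intro!: finite_PiE)
  have g: "(\<Sum>i\<in>I. p i * Re (\<chi> i x)) = g x" if "x \<in> V \<union> (T + uminus ` T)" for x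
    unfolding p_def g_def using that
    by (intro autocorrelation_eq_average B I \<chi> orth) (auto simp: V_def)
  have TT: "t - t' \<in> T + uminus ` T" if "t \<in> T" "t' \<in> T" for t t'
    using that by (metis set_plus_intro imageI diff_conv_add_uminus)
  have p0: "p i \<ge> 0" for i by (simp add: p_def)
  have p1: "sum p I = 1"
  proof -
    obtain t where "t \<in> T" using T by blast
    then have "0 \<in> T + uminus ` T" using TT[of t t] by simp
    then have "(\<Sum>i\<in>I. p i * Re (\<chi> i 0)) = g 0" by (intro g) auto
    then show ?thesis using cB by (simp add: character_0[OF \<chi>] g_def)
  qed
  have g_shift: "g (t - t') \<ge> 31 / 32" if "t \<in> T" "t' \<in> T" for t t'
  proof -
    have "card B = card {x\<in>B. x + (t - t') \<in> B} + card {x\<in>B. x + (t - t') \<notin> B}"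
      using B by (subst card_Un_disjoint[symmetric]) (auto intro!: arg_cong[where f = card])
    with shift[OF that] have "31 / 32 * card B \<le> real (card {x\<in>B. x + (t - t') \<in> B})" by linarith
    then show ?thesis using cB by (simp only: g_def pos_le_divide_eq of_nat_0_less_iff)
  qed
  have e1: "(\<Sum>s\<in>\<Omega>. w s * of_bool (E1 s)) \<le> exp (- (real d * (1 / 4)\<^sup>2 / 16))"
    unfolding \<Omega>_def w_def E1_def
  proof (rule chernoff_PiE)
    fix i assume i: "i \<in> I"
    have "\<bar>u i\<bar> \<le> (\<Sum>t'\<in>T. \<Sum>t\<in>T. \<bar>- Re (\<chi> i (t - t')) / (card T)\<^sup>2\<bar>)"
      unfolding u_def by (rule order_trans[OF sum_abs sum_mono]) (rule sum_abs)
    also have "\<dots> \<le> (\<Sum>t'\<in>T. \<Sum>t\<in>T. 1 / (card T)\<^sup>2)"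
      by (intro sum_mono) (simp add: abs_Re_character[OF \<chi>[OF i]] divide_right_mono)
    also have "\<dots> = 1" using cB by (simp add: power2_eq_square)
    finally show "\<bar>u i\<bar> \<le> 1" .
  next
    have "(\<Sum>i\<in>I. p i * u i) = (\<Sum>t'\<in>T. \<Sum>t\<in>T. - (\<Sum>i\<in>I. p i * Re (\<chi> i (t - t'))) / (card T)\<^sup>2)"
      unfolding u_def sum_distrib_left sum_negf[symmetric] sum_divide_distrib
      by (subst sum.swap, rule sum.cong[OF refl], subst sum.swap) simp
    also have "\<dots> = (\<Sum>t'\<in>T. \<Sum>t\<in>T. - g (t - t') / (card T)\<^sup>2)"
      using TT by (intro sum.cong refl) (simp add: g)
    also have "\<dots> \<le> (\<Sum>t'\<in>T. \<Sum>t\<in>T. - (31 / 32) / (card T)\<^sup>2)"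
      using g_shift by (intro sum_mono divide_right_mono) auto
    also have "\<dots> = - (31 / 32)" using cB by (simp add: power2_eq_square)
    finally show "(\<Sum>i\<in>I. p i * u i) \<le> - (31 / 32)" .
  qed (use I p0 p1 in auto)
  have e2: "(\<Sum>s\<in>\<Omega>. w s * of_bool (E2 x s)) \<le> exp (- (real d * (1 / 4)\<^sup>2 / 16))" if "x \<in> Z" for x
    unfolding \<Omega>_def w_def E2_def
    by (rule chernoff_PiE) (use I p0 p1 that \<chi> g in \<open>auto simp: Z_def abs_Re_character\<close>)
  \<comment> \<open>The weight \<open>4 / card T\<close> lets one expectation do two jobs: a value
    below \<open>1\<close> excludes \<open>E1\<close> and leaves \<open>E2\<close> on fewer than
    \<open>|T| / 4\<close> points of \<open>Z\<close>.\<close>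
  have "\<exists>s\<in>\<Omega>. of_bool (E1 s) + 4 / card T * (\<Sum>x\<in>Z. of_bool (E2 x s)) < (1 :: real)"
  proof (rule ccontr)
    assume *: "\<not> ?thesis"
    have "1 = (\<Sum>s\<in>\<Omega>. w s * 1)"
      unfolding \<Omega>_def w_def using I p1 by (simp add: sum_PiE_prod)
    also have "\<dots> \<le> (\<Sum>s\<in>\<Omega>. w s * (of_bool (E1 s) + 4 / card T * (\<Sum>x\<in>Z. of_bool (E2 x s))))"
      using * by (intro sum_mono mult_left_mono) (auto simp: w_def not_less p0 intro!: prod_nonneg)
    also have "\<dots> = (\<Sum>s\<in>\<Omega>. w s * of_bool (E1 s)) + 4 / card T * (\<Sum>x\<in>Z. \<Sum>s\<in>\<Omega>. w s * of_bool (E2 x s))"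
      by (subst sum.swap) (simp add: distrib_left sum.distrib sum_distrib_left sum_divide_distrib mult_ac)
    also have "\<dots> \<le> exp (- (real d * (1 / 4)\<^sup>2 / 16)) + 4 / card T * (\<Sum>x\<in>Z. exp (- (real d * (1 / 4)\<^sup>2 / 16)))"
      by (intro add_mono e1 mult_left_mono sum_mono e2) auto
    also have "\<dots> = exp (- (real d / 256)) * (1 + 4 * real (card Z) / card T)"
      by (simp add: power2_eq_square algebra_simps)
    also have "\<dots> \<le> exp (- (real d / 256)) * (1 + 4 * real (card V) / card T)"
      using finV by (intro mult_left_mono add_left_mono divide_right_mono) (auto simp: Z_def intro!: card_mono)
    also have "\<dots> < exp (- (real d / 256)) * exp (real d / 256)"
      using d by (simp add: V_def)
    finally show False by (simp flip: exp_add)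
  qed
  then obtain s where s: "s \<in> \<Omega>" and "of_bool (E1 s) + 4 / card T * (\<Sum>x\<in>Z. of_bool (E2 x s)) < (1 :: real)"
    by blast
  moreover have "0 \<le> 4 / card T * (\<Sum>x\<in>Z. of_bool (E2 x s) :: real)" by (intro mult_nonneg_nonneg sum_nonneg) auto
  ultimately have nE1: "\<not> E1 s" and "4 / card T * (\<Sum>x\<in>Z. of_bool (E2 x s)) < (1 :: real)"
    by (auto simp: of_bool_def split: if_splits)
  then have few: "4 * card {x\<in>Z. E2 x s} < card T"
    using cB finZ by (simp add: Int_def field_simps flip: of_nat_mult)
  have sI: "s j \<in> I" if "j < d" for j using s that by (auto simp: \<Omega>_def)
  define h where "h x = (\<Sum>j<d. Re (\<chi> (s j) x))" for x
  have hd: "h x \<le> d" for x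
  proof -
    have "h x \<le> (\<Sum>j<d. 1)" unfolding h_def
      using abs_Re_character[OF \<chi>[OF sI]] by (intro sum_mono) (auto simp: abs_le_iff)
    then show ?thesis by simp
  qed
  have "(\<Sum>j<d. u (s j)) = (\<Sum>t'\<in>T. \<Sum>t\<in>T. - h (t - t') / (card T)\<^sup>2)"
    unfolding u_def h_def sum_negf[symmetric] sum_divide_distrib
    by (subst sum.swap, rule sum.cong[OF refl], subst sum.swap) simp
  also have "\<dots> = - (\<Sum>t'\<in>T. \<Sum>t\<in>T. h (t - t')) / (card T)\<^sup>2"
    by (simp add: sum_negf flip: sum_divide_distrib)
  finally have "real d * (23 / 32) < (\<Sum>t'\<in>T. \<Sum>t\<in>T. h (t - t')) / (card T)\<^sup>2"
    using nE1 by (simp add: E1_def)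
  then have "(\<Sum>t'\<in>T. \<Sum>t\<in>T. h (t - t')) > (card T)\<^sup>2 * (real d * (23 / 32))"
    using cB by (simp add: pos_less_divide_eq mult.commute)
  moreover have "(\<Sum>t'\<in>T. \<Sum>t\<in>T. h (t - t')) \<le> (\<Sum>t'\<in>T. card T * (real d * (23 / 32)))"
    if "\<And>t'. t' \<in> T \<Longrightarrow> (\<Sum>t\<in>T. h (t - t')) \<le> card T * (real d * (23 / 32))"
    using that by (rule sum_mono)
  ultimately obtain t' where t': "t' \<in> T" "(\<Sum>t\<in>T. h (t - t')) > card T * (real d * (23 / 32))"
    by (force simp: power2_eq_square not_le[symmetric])
  \<comment> \<open>As \<open>h\<close> never exceeds \<open>d\<close> and averages more than
    \<open>23/32 * d\<close> over \<open>T - t'\<close>, more than a quarter of \<open>T\<close>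
    belongs to \<open>M\<close>, because \<open>23/32 > 1/4 + 3/4 * 3/5\<close>.\<close>
  define M where "M = {t\<in>T. h (t - t') \<ge> real d * (3 / 5)}"
  have M: "finite M" "M \<subseteq> T" "card M \<le> card T" using T by (auto simp: M_def intro!: card_mono)
  have "(\<Sum>t\<in>T. h (t - t')) \<le> (\<Sum>t\<in>T. if t \<in> M then real d else real d * (3 / 5))"
    using hd by (intro sum_mono) (auto simp: M_def)
  also have "\<dots> = card M * real d + (real (card T) - card M) * (real d * (3 / 5))"
    using M T by (simp add: sum.If_cases Int_absorb1 card_Diff_subset of_nat_diff flip: Diff_eq)
  also have "\<dots> = real d * (card M + (real (card T) - card M) * (3 / 5))"
    by (simp add: algebra_simps)
  finally have le: "(\<Sum>t\<in>T. h (t - t')) \<le> real d * (card M + (real (card T) - card M) * (3 / 5))" .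
  have "real d * (card T * (23 / 32)) = card T * (real d * (23 / 32))" by simp
  also note t'(2)
  also note le
  finally have "real d * (card T * (23 / 32)) < real d * (card M + (real (card T) - card M) * (3 / 5))" .
  then have "card T * (23 / 32) < card M + (real (card T) - card M) * (3 / 5)"
    by (rule mult_left_less_imp_less) simp
  then have "real (card T) < 4 * real (card M)"
    using of_nat_0_le_iff[of "card M", where ?'a = real] by argo
  then have cM: "card T < 4 * card M" by linarith
  have "x \<in> B + uminus ` B" if x: "x \<in> W" "\<And>j. j < d \<Longrightarrow> cmod (\<chi> (s j) x - 1) \<le> 1 / 10" for x
  proof (rule ccontr)
    assume *: "x \<notin> B + uminus ` B"
    have nB: "b + x \<notin> B" if "b \<in> B" for b
    proof
      assume "b + x \<in> B"
      then have "(b + x) + - b \<in> B + uminus ` B" using that by blast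
      then show False using * by simp
    qed
    have "x + (t - t') \<in> {x\<in>Z. E2 x s}" if t: "t \<in> M" for t
    proof -
      have tT: "t \<in> T" using t M by blast
      then have V: "x + (t - t') \<in> V" using x(1) t' TT by (auto simp: V_def)
      \<comment> \<open>As \<open>x\<close> is not in \<open>B - B\<close>, the points
        \<open>b + (t - t')\<close> and \<open>b + (t - t') + x\<close> are never both in
        \<open>B\<close>. If the latter is in \<open>B\<close>, then \<open>b\<close> has left
        \<open>B\<close> under the shift \<open>t - t'\<close>, which is rare.\<close>
      have "{b\<in>B. b + (x + (t - t')) \<in> B} \<subseteq> {b\<in>B. b + (t - t') \<notin> B}"
      proof clarify
        fix b assume "b \<in> B" "b + (x + (t - t')) \<in> B" "b + (t - t') \<in> B"
        then show False using nB[of "b + (t - t')"] by (simp add: add_ac)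
      qed
      then have "card {b\<in>B. b + (x + (t - t')) \<in> B} \<le> card {b\<in>B. b + (t - t') \<notin> B}"
        using B by (intro card_mono) auto
      then have "real (card {b\<in>B. b + (x + (t - t')) \<in> B}) \<le> card B / 32"
        using shift[OF tT t'(1)] by linarith
      then have g: "g (x + (t - t')) \<le> 1 / 32" using cB by (simp add: g_def field_simps)
      \<comment> \<open>Each factor \<open>\<chi> (s j) x\<close> is within \<open>1/10\<close> of
        \<open>1\<close>, so adding \<open>x\<close> lowers \<open>h\<close> by at most
        \<open>d / 10\<close>, and \<open>3/5 - 1/10\<close> still exceeds
        \<open>9/32\<close>.\<close>
      have "real d * (3 / 5) - d / 10 \<le> h (t - t') - (\<Sum>j<d. 1 / 10)" using t by (simp add: M_def)
      also have "\<dots> \<le> h (x + (t - t'))"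
        unfolding h_def sum_subtractf[symmetric]
      proof (rule sum_mono)
        fix j assume "j \<in> {..<d}"
        then have j: "character (\<chi> (s j))" "cmod (\<chi> (s j) x - 1) \<le> 1 / 10" using \<chi> sI x(2) by auto
        let ?z = "\<chi> (s j) (t - t')"
        have "Re (?z - ?z * \<chi> (s j) x) \<le> cmod (?z * (1 - \<chi> (s j) x))"
          by (simp add: right_diff_distrib complex_Re_le_cmod flip: minus_complex.simps)
        also have "\<dots> \<le> 1 / 10" using j by (simp add: norm_mult norm_minus_commute)
        finally show "Re ?z - 1 / 10 \<le> Re (\<chi> (s j) (x + (t - t')))"
          using j by (simp add: character_add mult.commute)
      qed
      finally have "E2 (x + (t - t')) s" unfolding E2_def h_def by simp
      then show ?thesis using V g by (simp add: Z_def)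
    qed
    then have "card M \<le> card {x\<in>Z. E2 x s}"
      using finZ by (intro card_inj_on_le[where f = "\<lambda>t. x + (t - t')"]) (auto simp: inj_on_def)
    then show False using few cM by linarith
  qed
  then show ?thesis using that sI by blast
qed

section \<open>The group of rationals modulo one\<close>

text \<open>The combinatorics takes place in the type \<open>'i \<Rightarrow> qz\<close>: every finitely generated Abelian group
  embeds into it because \<open>qz\<close> is divisible, it belongs to the class \<open>ab_group_add\<close>, and its
  coordinates supply the characters of finite order.\<close>

quotient_type qz = rat / "\<lambda>x y :: rat. x - y \<in> \<int>"
proof (rule equivpI)
  show "reflp (\<lambda>x y :: rat. x - y \<in> \<int>)" by (simp add: reflp_def)
  show "symp (\<lambda>x y :: rat. x - y \<in> \<int>)"
  proof (rule sympI)
    fix x y :: rat assume "x - y \<in> \<int>"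
    then have "- (x - y) \<in> \<int>" by (rule Ints_minus)
    then show "y - x \<in> \<int>" by simp
  qed
  show "transp (\<lambda>x y :: rat. x - y \<in> \<int>)"
  proof (rule transpI)
    fix x y z :: rat assume "x - y \<in> \<int>" "y - z \<in> \<int>"
    then have "(x - y) + (y - z) \<in> \<int>" by (rule Ints_add)
    then show "x - z \<in> \<int>" by simp
  qed
qed

instantiation qz :: ab_group_add
begin

lift_definition zero_qz :: qz is 0 .
lift_definition plus_qz :: "qz \<Rightarrow> qz \<Rightarrow> qz" is "(+)"
  by (simp add: add_diff_add)
lift_definition uminus_qz :: "qz \<Rightarrow> qz" is uminus
proof -
  fix x y :: rat assume "x - y \<in> \<int>"
  then have "- (x - y) \<in> \<int>" by (rule Ints_minus)
  then show "- x - - y \<in> \<int>" by simp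
qed
lift_definition minus_qz :: "qz \<Rightarrow> qz \<Rightarrow> qz" is "(-)"
proof -
  fix x y u v :: rat assume "x - y \<in> \<int>" "u - v \<in> \<int>"
  then have "(x - y) - (u - v) \<in> \<int>" by (rule Ints_diff)
  then show "x - u - (y - v) \<in> \<int>" by (simp add: algebra_simps)
qed

instance
  by standard (transfer; simp)+

end

lift_definition qz_scale :: "int \<Rightarrow> qz \<Rightarrow> qz" is "\<lambda>k q. of_int k * q"
proof -
  fix k :: int and x y :: rat assume "x - y \<in> \<int>"
  then have "of_int k * (x - y) \<in> \<int>" by simp
  then show "of_int k * x - of_int k * y \<in> \<int>" by (simp add: right_diff_distrib)
qed

lemma qz_scale_add: "qz_scale (k + l) q = qz_scale k q + qz_scale l q"
  by transfer (simp add: algebra_simps)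

lemma qz_scale_mult: "qz_scale (k * l) q = qz_scale k (qz_scale l q)"
  by transfer (simp add: algebra_simps)

lemma qz_scale_0 [simp]: "qz_scale 0 q = 0"
  by transfer simp

lemma qz_scale_1 [simp]: "qz_scale 1 q = q"
  by transfer simp

lemma qz_scale_minus: "qz_scale (- k) q = - qz_scale k q"
  by transfer simp

text \<open>For \<open>k > 1\<close> the roots \<open>c / k\<close> and \<open>(c + 1) / k\<close>
  differ by the non-integer \<open>1 / k\<close>, so they are not both zero modulo one. The nonzero
  root is what later lets homomorphisms separate points.\<close>

lemma qz_divisible:
  assumes "k \<ge> 1"
  obtains q where "qz_scale k q = c" "k \<noteq> 1 \<Longrightarrow> q \<noteq> 0"
proof (cases "k = 1")
  case True
  then show ?thesis using that[of c] by simp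
next
  case False
  have "\<exists>q. qz_scale k q = c \<and> q \<noteq> 0"
    using assms False
  proof (transfer)
    fix k :: int and c :: rat assume k: "k \<ge> 1" "k \<noteq> 1"
    have *: "1 / of_int k \<notin> (\<int> :: rat set)"
    proof
      assume "1 / of_int k \<in> (\<int> :: rat set)"
      then obtain m where "1 / rat_of_int k = of_int m" by (auto elim: Ints_cases)
      then have "1 = of_int m * rat_of_int k" using k by (simp add: field_simps)
      then have "1 = m * k" by (metis of_int_1 of_int_eq_iff of_int_mult)
      then show False using k zmult_eq_1_iff[of m k] by auto
    qed
    show "\<exists>q. of_int k * q - c \<in> \<int> \<and> q - 0 \<notin> \<int>"
    proof (cases "c / of_int k \<in> \<int>")
      case False
      then show ?thesis using k by (intro exI[of _ "c / of_int k"]) auto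
    next
      case True
      have "(c + 1) / of_int k \<notin> \<int>"
      proof
        assume "(c + 1) / of_int k \<in> \<int>"
        then have "(c + 1) / of_int k - c / of_int k \<in> \<int>" using True by (rule Ints_diff)
        then show False using * by (simp add: diff_divide_distrib[symmetric])
      qed
      then show ?thesis using k by (intro exI[of _ "(c + 1) / of_int k"]) auto
    qed
  qed
  then show ?thesis using that by blast
qed

lift_definition qz_cis :: "qz \<Rightarrow> complex" is "\<lambda>q. cis (2 * pi * of_rat q)"
proof -
  fix x y :: rat assume "x - y \<in> \<int>"
  then have "real_of_rat (x - y) \<in> \<int>"
    by (auto elim!: Ints_cases)
  then have "cis (2 * pi * of_rat (x - y)) = 1" by (rule cis_multiple_2pi)
  then have "cis (2 * pi * of_rat y) * cis (2 * pi * of_rat (x - y)) = cis (2 * pi * of_rat y)" by simp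
  then show "cis (2 * pi * of_rat x) = cis (2 * pi * of_rat y)"
    by (simp add: cis_mult of_rat_diff algebra_simps)
qed

lemma qz_cis_add: "qz_cis (x + y) = qz_cis x * qz_cis y"
  by transfer (simp add: cis_mult of_rat_add algebra_simps)

lemma norm_qz_cis [simp]: "cmod (qz_cis x) = 1"
  by transfer simp

lemma qz_cis_0 [simp]: "qz_cis 0 = 1"
  by transfer simp

lemma qz_cis_eq_1_iff: "qz_cis x = 1 \<longleftrightarrow> x = 0"
proof
  show "qz_cis x = 1 \<Longrightarrow> x = 0"
  proof transfer
    fix x :: rat assume "cis (2 * pi * of_rat x) = 1"
    then have "cos (2 * pi * of_rat x) = 1" by (metis cis.sel(1) one_complex.sel(1))
    then obtain n :: int where "2 * pi * real_of_rat x = of_int n * 2 * pi"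
      by (auto simp: cos_one_2pi_int)
    then have "real_of_rat x = real_of_rat (of_int n)" by simp
    then have "x = of_int n" by (simp only: of_rat_eq_iff)
    then show "x - 0 \<in> \<int>" by simp
  qed
qed simp

lemma qz_cis_torsion: "\<exists>N::nat. N \<ge> 1 \<and> qz_cis x ^ N = 1"
proof transfer
  fix x :: rat
  obtain a b where ab: "quotient_of x = (a, b)" by force
  have b: "b > 0" "x = of_int a / of_int b"
    using quotient_of_denom_pos[OF ab] quotient_of_div[OF ab] by auto
  have eq: "real_of_int b * real_of_rat x = of_int a"
    using b by (simp add: of_rat_divide)
  have "cis (2 * pi * of_rat x) ^ nat b = cis (2 * pi * (of_int b * of_rat x))"
    using b(1) by (simp add: DeMoivre mult_ac)
  also have "\<dots> = cis (2 * pi * of_int a)" by (simp only: eq)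
  also have "\<dots> = 1" by (intro cis_multiple_2pi) simp
  finally show "\<exists>N::nat. N \<ge> 1 \<and> cis (2 * pi * of_rat x) ^ N = 1"
    using b by (intro exI[of _ "nat b"]) auto
qed

lemma qz_cis_torsion_finite:
  assumes "finite Q"
  shows "\<exists>N::nat. N \<ge> 1 \<and> (\<forall>x\<in>Q. qz_cis x ^ N = 1)"
  using assms
proof (induction Q)
  case (insert x Q)
  then obtain N M :: nat where "N \<ge> 1" "\<forall>x\<in>Q. qz_cis x ^ N = 1" "M \<ge> 1" "qz_cis x ^ M = 1"
    using qz_cis_torsion by blast
  then show ?case
  proof (intro exI[of _ "N * M"] conjI ballI)
    fix y assume "y \<in> insert x Q"
    moreover have "qz_cis y ^ (N * M) = (qz_cis y ^ N) ^ M" "qz_cis y ^ (N * M) = (qz_cis y ^ M) ^ N"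
      by (simp_all add: mult.commute flip: power_mult)
    ultimately show "qz_cis y ^ (N * M) = 1"
      using \<open>\<forall>x\<in>Q. qz_cis x ^ N = 1\<close> \<open>qz_cis x ^ M = 1\<close> by auto
  qed simp
qed auto

lemma character_coordinates:
  "character (\<lambda>x :: 'i \<Rightarrow> qz. \<Prod>i\<in>J. qz_cis (x i) ^ m i)"
  by (auto simp: character_def qz_cis_add power_mult_distrib prod.distrib norm_power simp flip: prod_norm)

text \<open>\<open>J\<close> holds one detecting coordinate for each nonzero point of
  \<open>W\<close>, and \<open>N\<close> is a common exponent of the values there. The sum over
  exponent vectors below \<open>N\<close> factors into geometric sums, and the one at a detecting
  coordinate vanishes.\<close>

lemma orthogonal_characters:
  fixes W :: "('i \<Rightarrow> qz) set"
  assumes W: "finite W"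
  obtains I :: "('i \<Rightarrow> nat) set" and \<chi> where "finite I" "I \<noteq> {}" "\<And>m. m \<in> I \<Longrightarrow> character (\<chi> m)"
    "\<And>x. x \<in> W \<Longrightarrow> (\<Sum>m\<in>I. \<chi> m x) = of_nat (card I) * of_bool (x = 0)"
proof -
  define J where "J = (\<lambda>x. SOME i. x i \<noteq> 0) ` (W - {0})"
  have J: "\<exists>i\<in>J. x i \<noteq> 0" if "x \<in> W" "x \<noteq> 0" for x
  proof -
    have "\<exists>i. x i \<noteq> 0" using that by (metis ext zero_fun_apply)
    then have "x (SOME i. x i \<noteq> 0) \<noteq> 0" by (rule someI_ex)
    then show ?thesis using that by (auto simp: J_def)
  qed
  have finJ: "finite J" using W by (simp add: J_def)
  obtain N :: nat where N: "N \<ge> 1" "\<And>x i. x \<in> W \<Longrightarrow> i \<in> J \<Longrightarrow> qz_cis (x i) ^ N = 1"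
    using qz_cis_torsion_finite[of "(\<lambda>(x, i). x i) ` (W \<times> J)"] W finJ by auto
  define I where "I = PiE J (\<lambda>_. {..<N})"
  define \<chi> where "\<chi> m x = (\<Prod>i\<in>J. qz_cis (x i) ^ m i)" for m and x :: "'i \<Rightarrow> qz"
  have "(\<Sum>m\<in>I. \<chi> m x) = of_nat (card I) * of_bool (x = 0)" if x: "x \<in> W" for x
  proof -
    have "(\<Sum>m\<in>I. \<chi> m x) = (\<Prod>i\<in>J. \<Sum>k<N. qz_cis (x i) ^ k)"
      unfolding \<chi>_def I_def using finJ by (subst prod_sum_PiE) auto
    also have "\<dots> = of_nat (card I) * of_bool (x = 0)"
    proof (cases "x = 0")
      case True
      then show ?thesis using finJ by (simp add: I_def card_PiE)
    next
      case False
      then obtain i where i: "i \<in> J" "x i \<noteq> 0" using J x by blast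
      have "(\<Sum>k<N. qz_cis (x i) ^ k) = 0"
        using N(2)[OF x i(1)] i(2) by (simp add: geometric_sum qz_cis_eq_1_iff)
      then show ?thesis using False i finJ by auto
    qed
    finally show ?thesis .
  qed
  moreover have "finite I" "I \<noteq> {}" using finJ N(1) by (auto simp: I_def PiE_eq_empty_iff lessThan_empty_iff intro!: finite_PiE)
  ultimately show ?thesis using that[of I \<chi>] by (simp add: \<chi>_def[abs_def] character_coordinates)
qed

section \<open>Embedding into powers of the rationals modulo one\<close>

text \<open>Only values on \<open>H\<close> are constrained, so a map can be enlarged generator by
  generator without changing its type.\<close>

definition qz_hom :: "('a, 'b) monoid_scheme \<Rightarrow> 'a set \<Rightarrow> ('a \<Rightarrow> qz) \<Rightarrow> bool" where
  "qz_hom G H f \<longleftrightarrow> (\<forall>x\<in>H. \<forall>y\<in>H. f (x \<otimes>\<^bsub>G\<^esub> y) = f x + f y)"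

context comm_group
begin

lemma qz_hom_one: 
  assumes "subgroup H G" "qz_hom G H f"
  shows "f \<one> = 0"
proof -
  have "f (\<one> \<otimes> \<one>) = f \<one> + f \<one>" using assms(2) subgroup.one_closed[OF assms(1)] unfolding qz_hom_def by blast
  then show ?thesis by simp
qed

lemma qz_hom_int_pow:
  assumes H: "subgroup H G" "qz_hom G H f" "x \<in> H"
  shows "f (x [^] (k::int)) = qz_scale k (f x)"
proof -
  have x: "x \<in> carrier G" using subgroup.mem_carrier[OF H(1,3)] .
  have nat: "f (x [^] n) = qz_scale (int n) (f x) \<and> x [^] n \<in> H" for n :: nat
  proof (induction n)
    case 0
    then show ?case using H by (simp add: qz_hom_one[OF H(1,2)] subgroup.one_closed)
  next
    case (Suc n)
    then show ?case using H(2,3) subgroup.m_closed[OF H(1)]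
      by (simp add: qz_hom_def qz_scale_add add.commute)
  qed
  have minus: "f (inv y) = - f y" if "y \<in> H" for y
  proof -
    have "y \<in> carrier G" using subgroup.mem_carrier[OF H(1) that] .
    then have "f (y \<otimes> inv y) = 0" using H by (simp add: qz_hom_one[OF H(1,2)])
    moreover have "f (y \<otimes> inv y) = f y + f (inv y)"
      using H(2) that subgroup.m_inv_closed[OF H(1)] by (simp add: qz_hom_def)
    ultimately show ?thesis by (metis add.inverse_unique)
  qed
  show ?thesis
  proof (cases k)
    case (nonneg n)
    then show ?thesis using nat by (simp add: int_pow_int)
  next
    case (neg n)
    then have "x [^] k = inv (x [^] Suc n)" using x by (simp only: int_pow_neg int_pow_int)
    then show ?thesis using nat[of "Suc n"] minus neg by (simp only: qz_scale_minus)
  qed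
qed

text \<open>The exponents \<open>k\<close> with \<open>a [^] k \<in> H\<close> are the multiples of
  the least positive one, \<open>k0\<close>, so dividing \<open>f (a [^] k0)\<close> by
  \<open>k0\<close> settles them all. If only \<open>0\<close> qualifies, \<open>q\<close> is free
  and an element of order two serves.\<close>

lemma qz_hom_extend_value:
  assumes H: "subgroup H G" "qz_hom G H f" and a: "a \<in> carrier G"
  obtains q where "\<And>k::int. a [^] k \<in> H \<Longrightarrow> f (a [^] k) = qz_scale k q" "a \<notin> H \<Longrightarrow> q \<noteq> 0"
proof (cases "\<exists>k::nat. k \<ge> 1 \<and> a [^] k \<in> H")
  case False
  obtain q where q: "qz_scale 2 q = 0" "q \<noteq> 0" using qz_divisible[of 2 0] by auto
  have k0: "k = 0" if "a [^] k \<in> H" for k :: int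
  proof (rule ccontr)
    assume "k \<noteq> 0"
    moreover have "a [^] (- k) \<in> H"
      using that a subgroup.m_inv_closed[OF H(1)] by (simp add: int_pow_neg)
    then have "a [^] \<bar>k\<bar> \<in> H" using that by (auto simp: abs_if)
    then have "a [^] nat \<bar>k\<bar> \<in> H" using int_pow_int[of _ a "nat \<bar>k\<bar>"] by simp
    moreover have "nat \<bar>k\<bar> \<ge> 1" using \<open>k \<noteq> 0\<close> by simp
    ultimately show False using False by blast
  qed
  show ?thesis
  proof (rule that)
    fix k :: int assume "a [^] k \<in> H"
    then show "f (a [^] k) = qz_scale k q" using k0 qz_hom_one[OF H] by (metis int_pow_0 qz_scale_0)
  qed (use q in auto)
next
  case True
  define k0 where "k0 = (LEAST k::nat. k \<ge> 1 \<and> a [^] k \<in> H)"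
  have k0: "k0 \<ge> 1" "a [^] k0 \<in> H" using LeastI_ex[OF True] by (auto simp: k0_def)
  obtain q where q: "qz_scale (int k0) q = f (a [^] k0)" "int k0 \<noteq> 1 \<Longrightarrow> q \<noteq> 0"
    using qz_divisible[of "int k0" "f (a [^] k0)"] k0 by auto
  show ?thesis
  proof (rule that)
    fix k :: int assume k: "a [^] k \<in> H"
    define m where "m = k div int k0"
    define r where "r = nat (k mod int k0)"
    have r: "int r = k mod int k0" using k0 by (simp add: r_def)
    then have kr: "k = int k0 * m + int r" by (simp add: m_def)
    have pw: "a [^] (int k0 * m) = (a [^] k0) [^] m"
      using a by (simp add: int_pow_pow[symmetric] int_pow_int)
    have "(a [^] k0) [^] m \<in> H"
      using k0 H(1) by (simp add: subgroup_int_pow_closed)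
    moreover have "a [^] int r = a [^] (k - int k0 * m)" using kr by simp
    then have "a [^] r = a [^] k \<otimes> inv ((a [^] k0) [^] m)"
      using a by (simp add: int_pow_diff pw int_pow_int)
    ultimately have "a [^] r \<in> H"
      using k H(1) by (simp add: subgroup.m_closed subgroup.m_inv_closed)
    moreover have "r < k0" using k0 r pos_mod_bound[of "int k0" k] by linarith
    ultimately have "r = 0" using not_less_Least[of r "\<lambda>k. k \<ge> 1 \<and> a [^] k \<in> H"]
      unfolding k0_def by auto
    then have "f (a [^] k) = qz_scale m (f (a [^] k0))"
      using kr pw qz_hom_int_pow[OF H k0(2)] by simp
    then show "f (a [^] k) = qz_scale k q"
      using \<open>r = 0\<close> kr by (simp add: qz_scale_mult[symmetric] q(1)[symmetric] mult.commute)
  next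
    assume "a \<notin> H"
    then have "k0 \<noteq> 1" using k0 a by auto
    then show "q \<noteq> 0" using q by simp
  qed
qed

text \<open>The map sends \<open>h \<otimes> a [^] k\<close> to \<open>f h + qz_scale k q\<close>.
  By the choice of \<open>q\<close> this does not depend on the representation that
  \<open>SOME\<close> picks.\<close>

lemma qz_hom_extend:
  assumes H: "subgroup H G" "qz_hom G H f" and a: "a \<in> carrier G"
  obtains H' f' where "subgroup H' G" "qz_hom G H' f'" "H \<subseteq> H'" "a \<in> H'"
    "\<And>x. x \<in> H \<Longrightarrow> f' x = f x" "a \<notin> H \<Longrightarrow> f' a \<noteq> 0"
proof -
  obtain q where q: "\<And>k::int. a [^] k \<in> H \<Longrightarrow> f (a [^] k) = qz_scale k q" "a \<notin> H \<Longrightarrow> q \<noteq> 0"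
    using qz_hom_extend_value[OF assms] by blast
  have Hc: "h \<in> carrier G" if "h \<in> H" for h using subgroup.mem_carrier[OF H(1) that] .
  define H' where "H' = {h \<otimes> a [^] k | h k::int. h \<in> H}"
  define f' where "f' y = (let (h, k) = (SOME (h, k::int). h \<in> H \<and> y = h \<otimes> a [^] k) in f h + qz_scale k q)" for y
  have f': "f' (h \<otimes> a [^] k) = f h + qz_scale k q" if h: "h \<in> H" for h and k :: int
  proof -
    define p where "p = (SOME (h', k'::int). h' \<in> H \<and> h \<otimes> a [^] k = h' \<otimes> a [^] k')"
    have "case p of (h', k') \<Rightarrow> h' \<in> H \<and> h \<otimes> a [^] k = h' \<otimes> a [^] k'"
      unfolding p_def by (rule someI[of _ "(h, k)"]) (use h in auto)
    then obtain h' k' where p: "p = (h', k')" "h' \<in> H" "h \<otimes> a [^] k = h' \<otimes> a [^] k'"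
      by (cases p) auto
    have "a [^] (k - k') = inv h \<otimes> (h \<otimes> a [^] k) \<otimes> inv (a [^] k')"
      using a Hc[OF h] by (simp add: int_pow_diff m_assoc[symmetric])
    also have "\<dots> = inv h \<otimes> h'"
      unfolding p(3) using a Hc[OF h] Hc[OF p(2)] by (simp add: m_assoc)
    finally have eq: "a [^] (k - k') = inv h \<otimes> h'" .
    then have "a [^] (k - k') \<in> H"
      using h p(2) H(1) by (simp add: subgroup.m_closed subgroup.m_inv_closed)
    then have "f (a [^] (k - k')) = qz_scale (k - k') q" by (rule q)
    moreover have "f (h \<otimes> a [^] (k - k')) = f h + f (a [^] (k - k'))"
      using H(2) h \<open>a [^] (k - k') \<in> H\<close> by (simp add: qz_hom_def)
    moreover have "h \<otimes> a [^] (k - k') = h'"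
      unfolding eq using Hc[OF h] Hc[OF p(2)] by (simp add: m_assoc[symmetric])
    ultimately have "f h' = f h + qz_scale (k - k') q" by simp
    then have "f h' + qz_scale k' q = f h + qz_scale k q"
      by (simp add: add.assoc flip: qz_scale_add)
    then show ?thesis unfolding f'_def p_def[symmetric] using p(1) by simp
  qed
  have mult: "(h \<otimes> a [^] k) \<otimes> (h' \<otimes> a [^] k') = (h \<otimes> h') \<otimes> a [^] (k + k')"
    if "h \<in> H" "h' \<in> H" for h h' and k k' :: int
    using a Hc[OF that(1)] Hc[OF that(2)] by (simp add: int_pow_mult m_ac)
  show ?thesis
  proof (rule that[of H' f'])
    show "subgroup H' G"
    proof (rule subgroupI)
      show "H' \<subseteq> carrier G" using a Hc by (auto simp: H'_def)
      show "H' \<noteq> {}" using H(1) subgroup.one_closed by (auto simp: H'_def)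
    next
      fix x assume "x \<in> H'"
      then obtain h and k :: int where "h \<in> H" "x = h \<otimes> a [^] k" by (auto simp: H'_def)
      then have "inv x = inv h \<otimes> a [^] (- k)" "inv h \<in> H"
        using a Hc H(1) by (auto simp: inv_mult int_pow_neg subgroup.m_inv_closed)
      then show "inv x \<in> H'" by (auto simp: H'_def)
    next
      fix x y assume "x \<in> H'" "y \<in> H'"
      then obtain h h' and k k' :: int where "h \<in> H" "x = h \<otimes> a [^] k" "h' \<in> H" "y = h' \<otimes> a [^] k'"
        by (auto simp: H'_def)
      then have "x \<otimes> y = (h \<otimes> h') \<otimes> a [^] (k + k')" "h \<otimes> h' \<in> H"
        using mult subgroup.m_closed[OF H(1)] by auto
      then show "x \<otimes> y \<in> H'" unfolding H'_def by blast
    qed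
    show "qz_hom G H' f'"
      unfolding qz_hom_def
    proof (intro ballI)
      fix x y assume "x \<in> H'" "y \<in> H'"
      then obtain h h' and k k' :: int where xy: "h \<in> H" "x = h \<otimes> a [^] k" "h' \<in> H" "y = h' \<otimes> a [^] k'"
        by (auto simp: H'_def)
      have "f (h \<otimes> h') = f h + f h'" using H(2) xy by (simp add: qz_hom_def)
      then show "f' (x \<otimes> y) = f' x + f' y"
        using xy by (simp add: mult f' subgroup.m_closed[OF H(1)] qz_scale_add add_ac)
    qed
    show "H \<subseteq> H'"
    proof
      fix x assume "x \<in> H"
      moreover from this have "x = x \<otimes> a [^] (0::int)" using Hc by simp
      ultimately show "x \<in> H'" unfolding H'_def by blast
    qed
    show "f' x = f x" if "x \<in> H" for x
      using f'[OF that, of 0] Hc[OF that] by simp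
    have a1: "a = \<one> \<otimes> a [^] (1::int)" using a by simp
    then show "a \<in> H'" unfolding H'_def using subgroup.one_closed[OF H(1)] by blast
    have "f' (\<one> \<otimes> a [^] (1::int)) = q"
      using f'[OF subgroup.one_closed[OF H(1)], of 1] qz_hom_one[OF H] by simp
    then show "f' a \<noteq> 0" if "a \<notin> H" using q(2)[OF that] a1 by simp
  qed
qed

text \<open>Adjoining \<open>x\<close> to the trivial subgroup with a nonzero value comes first; the
  finitely many elements of \<open>A\<close> are then adjoined one at a time, so no transfinite
  extension is involved.\<close>

lemma exists_separating_qz_hom:
  assumes A: "finite A" "A \<subseteq> carrier G" and x: "x \<in> carrier G" "x \<noteq> \<one>"
  shows "\<exists>f. qz_hom G (generate G A) f \<and> f x \<noteq> 0"
proof -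
  have "\<exists>H f. subgroup H G \<and> qz_hom G H f \<and> A \<subseteq> H \<and> x \<in> H \<and> f x \<noteq> 0"
    using A
  proof (induction A)
    case empty
    have "subgroup {\<one>} G" "qz_hom G {\<one>} (\<lambda>_. 0)" by (auto simp: triv_subgroup qz_hom_def)
    from qz_hom_extend[OF this x(1)] show ?case using x by (metis empty_subsetI singletonD)
  next
    case (insert a A)
    then obtain H f where "subgroup H G" "qz_hom G H f" "A \<subseteq> H" "x \<in> H" "f x \<noteq> 0" by auto
    moreover obtain H' f' where "subgroup H' G" "qz_hom G H' f'" "H \<subseteq> H'" "a \<in> H'" "\<And>x. x \<in> H \<Longrightarrow> f' x = f x"
      by (rule qz_hom_extend[OF \<open>subgroup H G\<close> \<open>qz_hom G H f\<close>, of a]) (use insert.prems in auto)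
    ultimately show ?case by (metis insert_subset subset_trans subsetD)
  qed
  then obtain H f where H: "subgroup H G" "qz_hom G H f" "A \<subseteq> H" "f x \<noteq> 0" by blast
  then have "generate G A \<subseteq> H" by (simp add: generate_subgroup_incl)
  then have "qz_hom G (generate G A) f" using H(2) unfolding qz_hom_def by blast
  then show ?thesis using H(4) by blast
qed

lemma embed_qz_power:
  assumes A: "finite A" "A \<subseteq> carrier G"
  obtains \<phi> :: "'a \<Rightarrow> ('a \<Rightarrow> qz) \<Rightarrow> qz" where "inj_on \<phi> (generate G A)"
    "\<And>x y. x \<in> generate G A \<Longrightarrow> y \<in> generate G A \<Longrightarrow> \<phi> (x \<otimes> y) = \<phi> x + \<phi> y"
proof
  let ?H = "generate G A"
  \<comment> \<open>Evaluation at all homomorphisms at once. Coordinates indexed by other functions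
    get \<open>0\<close>, which keeps \<open>\<phi>\<close> additive.\<close>
  define \<phi> where "\<phi> x f = (if qz_hom G ?H f then f x else 0)" for x f
  have H: "subgroup ?H G" using A(2) by (rule generate_is_subgroup)
  show hom: "\<phi> (x \<otimes> y) = \<phi> x + \<phi> y" if "x \<in> ?H" "y \<in> ?H" for x y
    using that by (auto simp: \<phi>_def qz_hom_def fun_eq_iff)
  show "inj_on \<phi> ?H"
  proof (rule inj_onI, rule ccontr)
    fix x y assume xy: "x \<in> ?H" "y \<in> ?H" "\<phi> x = \<phi> y" "x \<noteq> y"
    then have c: "x \<in> carrier G" "y \<in> carrier G" using subgroup.mem_carrier[OF H] by auto
    have iy: "x \<otimes> inv y \<in> ?H" using xy H by (simp add: subgroup.m_closed subgroup.m_inv_closed)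
    have "x = (x \<otimes> inv y) \<otimes> y" using c by (simp add: m_assoc)
    then have "\<phi> x = \<phi> (x \<otimes> inv y) + \<phi> y" using hom[OF iy xy(2)] by metis
    then have 0: "\<phi> (x \<otimes> inv y) = 0" using xy(3) by simp
    have "x \<otimes> inv y \<noteq> \<one>" using xy(4) c \<open>x = (x \<otimes> inv y) \<otimes> y\<close> by auto
    then obtain f where "qz_hom G ?H f" "f (x \<otimes> inv y) \<noteq> 0"
      using exists_separating_qz_hom[OF A, of "x \<otimes> inv y"] c by auto
    then show False using 0 by (auto simp: \<phi>_def fun_eq_iff split: if_splits)
  qed
qed

end

section \<open>Bohr sets\<close>

text \<open>The points in the union bound lie in \<open>7A - 7A\<close>, so there are at most
  \<open>K ^ 14 * |A| \<le> 2 * K ^ (14 + l) * |T|\<close> of them. The \<open>9\<close> arises as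
  \<open>1 + 4 * 2\<close>.\<close>

lemma exists_bohr_set:
  fixes A :: "('i \<Rightarrow> qz) set" and K :: real
  assumes A: "finite A" "A \<noteq> {}" and K: "K \<ge> 1" "real (card (A + A)) \<le> K * card A"
    and n: "n \<ge> 1" "(65 / 64) ^ n > 2 * K"
    and l: "l \<ge> 1" "2 * K ^ 3 * exp (- (real l * (1 / (4 * real n))\<^sup>2 / 16)) \<le> 1 / 512"
    and d: "9 * K ^ (14 + l) < exp (real d / 256)"
  obtains \<psi> where "\<And>j. j < d \<Longrightarrow> character (\<psi> j)"
    "\<And>x. x \<in> mixsum 6 6 A \<Longrightarrow> (\<And>j. j < d \<Longrightarrow> cmod (\<psi> j x - 1) \<le> 1 / 10) \<Longrightarrow> x \<in> mixsum 3 3 A"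
proof -
  obtain B T where BT: "B \<subseteq> mixsum 2 1 A" "card A \<le> card B" "T \<subseteq> A" "real (card A) \<le> 2 * K ^ l * card T"
    and shift: "\<And>t t'. t \<in> T \<Longrightarrow> t' \<in> T \<Longrightarrow> real (card {x\<in>B. x + (t - t') \<notin> B}) \<le> card B / 32"
    using croot_sisask[OF A K n l] by blast
  have cA: "card A > 0" using A by (simp add: card_gt_0_iff)
  have B: "finite B" "B \<noteq> {}" using BT(1,2) A cA finite_mixsum by (auto intro: finite_subset)
  have T: "finite T" "T \<noteq> {}" using BT(3,4) A cA by (auto intro: finite_subset)
  then have cT: "card T > 0" by (simp add: card_gt_0_iff)
  define V where "V = mixsum 6 6 A + (T + uminus ` T)"
  have "T + uminus ` T \<subseteq> mixsum 1 1 A"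
    using BT(3) by (simp add: mixsum_def set_plus_mono2 image_mono)
  then have "V \<subseteq> mixsum 6 6 A + mixsum 1 1 A" unfolding V_def by (intro set_plus_mono2) auto
  then have "card V \<le> card (mixsum 7 7 A)"
    using A by (intro card_mono) (auto simp: mixsum_add finite_mixsum)
  then have "real (card V) \<le> K ^ 14 * card A"
    using card_mixsum_le[OF A K, of 7 7] by simp
  also have "\<dots> \<le> K ^ 14 * (2 * K ^ l * card T)"
    using BT(4) K by (intro mult_left_mono) auto
  finally have "real (card V) / card T \<le> 2 * K ^ (14 + l)"
    using cT by (simp add: field_simps power_add)
  moreover have "1 \<le> K ^ (14 + l)" using K by simp
  ultimately have dV: "1 + 4 * real (card V) / card T < exp (real d / 256)"
    using d by simp
  \<comment> \<open>All arguments at which the sampling argument will ask for exact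
    orthogonality.\<close>
  define W where "W = (\<lambda>(x, b, b'). x + b - b') ` ((V \<union> (T + uminus ` T)) \<times> B \<times> B)"
  have "finite V" "finite (T + uminus ` T)"
    using A T by (simp_all add: V_def finite_set_plus finite_mixsum)
  then have "finite W" using B by (simp add: W_def)
  then obtain I :: "('i \<Rightarrow> nat) set" and \<chi> where I: "finite I" "I \<noteq> {}" "\<And>m. m \<in> I \<Longrightarrow> character (\<chi> m)"
    "\<And>x. x \<in> W \<Longrightarrow> (\<Sum>m\<in>I. \<chi> m x) = of_nat (card I) * of_bool (x = 0)"
    using orthogonal_characters[of W] by blast
  obtain s where s: "\<And>j. j < d \<Longrightarrow> s j \<in> I"
    "\<And>x. x \<in> mixsum 6 6 A \<Longrightarrow> (\<And>j. j < d \<Longrightarrow> cmod (\<chi> (s j) x - 1) \<le> 1 / 10) \<Longrightarrow> x \<in> B + uminus ` B"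
  proof (rule sample_characters[OF B T finite_mixsum[OF A(1), of 6 6] shift I(1,2,3)])
    fix x b b' assume "x \<in> (mixsum 6 6 A + (T + uminus ` T)) \<union> (T + uminus ` T)" "b \<in> B" "b' \<in> B"
    then show "(\<Sum>i\<in>I. \<chi> i (x + b - b')) = of_nat (card I) * of_bool (x + b - b' = 0)"
      by (intro I(4)) (force simp: W_def V_def)
  qed (use dV in \<open>auto simp: V_def\<close>)
  have "B + uminus ` B \<subseteq> mixsum 2 1 A + uminus ` mixsum 2 1 A"
    using BT(1) by (intro set_plus_mono2 image_mono)
  also have "\<dots> = mixsum 3 3 A" by (simp add: uminus_mixsum mixsum_add numeral_3_eq_3)
  finally show ?thesis using that[of "\<lambda>j. \<chi> (s j)"] s I(3) by blast
qed

text \<open>Each summand from \<open>X\<close> moves a character by at most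
  \<open>1 / (10 k)\<close>, so up to \<open>k\<close> summands remain within \<open>1/10\<close>
  and the hypothesis applies at every step. For the size, \<open>A\<close> is sorted into cells by
  its character values; differences from one point of a popular cell lie in
  \<open>X\<close>.\<close>

lemma bohr_set_structure:
  fixes A :: "'a::ab_group_add set"
  assumes A: "finite A" "A \<noteq> {}" and k: "k \<ge> 1"
    and \<psi>: "\<And>j. j < d \<Longrightarrow> character (\<psi> j)"
      "\<And>x. x \<in> mixsum 6 6 A \<Longrightarrow> (\<And>j. j < d \<Longrightarrow> cmod (\<psi> j x - 1) \<le> 1 / 10) \<Longrightarrow> x \<in> mixsum 3 3 A"
  obtains X where "0 \<in> X" "uminus ` X = X" "\<forall>m\<le>k. nsum m X \<subseteq> mixsum 3 3 A"
    "card A \<le> card X * (40 * k + 1) ^ (2 * d)"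
proof -
  define X where "X = {x\<in>mixsum 3 3 A. \<forall>j<d. cmod (\<psi> j x - 1) \<le> 1 / (10 * real k)}"
  have fin: "finite X" using A by (simp add: X_def finite_mixsum)
  have 0: "0 \<in> X" using A \<psi>(1) by (auto simp: X_def zero_in_mixsum character_0)
  have neg: "- x \<in> X" if "x \<in> X" for x
  proof -
    have "- x \<in> uminus ` mixsum 3 3 A" using that by (auto simp: X_def)
    then have "- x \<in> mixsum 3 3 A" by (simp add: uminus_mixsum)
    moreover have "cmod (\<psi> j (- x) - 1) = cmod (\<psi> j x - 1)" if "j < d" for j
    proof -
      have "\<psi> j (- x) - 1 = cnj (\<psi> j x - 1)" using \<psi>(1)[OF that] by (simp add: character_uminus)
      then show ?thesis by (simp only: complex_mod_cnj)
    qed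
    ultimately show ?thesis using that by (simp add: X_def)
  qed
  have symX: "uminus ` X = X"
  proof
    show "X \<subseteq> uminus ` X" using neg by (metis image_eqI minus_minus subsetI)
  qed (use neg in auto)
  have "nsum m X \<subseteq> {x\<in>mixsum 3 3 A. \<forall>j<d. cmod (\<psi> j x - 1) \<le> real m / (10 * real k)}" if "m \<le> k" for m
    using that
  proof (induction m)
    case 0
    show ?case using A \<psi>(1) by (auto simp: zero_in_mixsum character_0)
  next
    case (Suc m)
    show ?case
    proof
      fix z assume "z \<in> nsum (Suc m) X"
      then obtain x y where z: "z = x + y" "x \<in> X" "y \<in> nsum m X" by (auto simp: set_plus_def)
      then have xy: "x \<in> mixsum 3 3 A" "y \<in> mixsum 3 3 A" using Suc by (auto simp: X_def)
      then have "z \<in> mixsum 3 3 A + mixsum 3 3 A" using z by blast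
      then have z6: "z \<in> mixsum 6 6 A" by (simp add: mixsum_add)
      have close: "cmod (\<psi> j z - 1) \<le> real (Suc m) / (10 * real k)" if j: "j < d" for j
      proof -
        have "\<psi> j z - 1 = \<psi> j y * (\<psi> j x - 1) + (\<psi> j y - 1)"
          using character_add[OF \<psi>(1)[OF j], of x y] z(1) by (simp add: algebra_simps)
        then have "cmod (\<psi> j z - 1) \<le> cmod (\<psi> j y * (\<psi> j x - 1)) + cmod (\<psi> j y - 1)"
          by (metis norm_triangle_ineq)
        also have "\<dots> \<le> 1 / (10 * real k) + real m / (10 * real k)"
          using Suc z j \<psi>(1) by (intro add_mono) (auto simp: norm_mult X_def)
        finally show ?thesis by (simp add: add_divide_distrib)
      qed
      have "real (Suc m) / (10 * real k) \<le> 1 / 10" using Suc.prems k by (simp add: field_simps)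
      then have "z \<in> mixsum 3 3 A" using close z6 by (intro \<psi>(2)) (rule z6, rule order_trans)
      then show "z \<in> {x\<in>mixsum 3 3 A. \<forall>j<d. cmod (\<psi> j x - 1) \<le> real (Suc m) / (10 * real k)}"
        using close by blast
    qed
  qed
  then have sub: "nsum m X \<subseteq> mixsum 3 3 A" if "m \<le> k" for m using that by blast

  \<comment> \<open>Cells of side \<open>1 / (20 k)\<close> in real and imaginary part, so two
    values in one cell differ by at most \<open>1 / (10 k)\<close>. Each axis has the
    \<open>40 k + 1\<close> labels in \<open>R\<close>.\<close>
  define q where "q t = \<lfloor>20 * real k * t\<rfloor>" for t
  define R where "R = {- (20 * int k)..20 * int k}"
  define \<Phi> where "\<Phi> a = (\<lambda>j\<in>{..<d}. (q (Re (\<psi> j a)), q (Im (\<psi> j a))))" for a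
  have "\<exists>c\<in>PiE {..<d} (\<lambda>_. R \<times> R). card (\<Phi> -` {c} \<inter> A) * card (PiE {..<d} (\<lambda>_. R \<times> R)) \<ge> card A"
  proof (rule pigeonhole_card)
    have qR: "q t \<in> R" if "\<bar>t\<bar> \<le> 1" for t
    proof -
      have "20 * real k * t \<le> 20 * real k * 1" "20 * real k * (- 1) \<le> 20 * real k * t"
        using that by (intro mult_left_mono; simp add: abs_le_iff)+
      then have "- (20 * int k) \<le> q t" "q t \<le> 20 * int k"
        unfolding q_def by (simp_all add: le_floor_iff floor_le_iff)
      then show ?thesis by (simp add: R_def)
    qed
    have "\<bar>Re (\<psi> j a)\<bar> \<le> 1" "\<bar>Im (\<psi> j a)\<bar> \<le> 1" if "j < d" for j a
      using \<psi>(1)[OF that] by (metis abs_Re_le_cmod abs_Im_le_cmod cmod_character)+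
    then show "\<Phi> \<in> A \<rightarrow> PiE {..<d} (\<lambda>_. R \<times> R)" using qR by (auto simp: \<Phi>_def)
    show "PiE {..<d} (\<lambda>_. R \<times> R) \<noteq> {}" by (auto simp: PiE_eq_empty_iff R_def)
    show "finite (PiE {..<d} (\<lambda>_. R \<times> R))" by (intro finite_PiE) (auto simp: R_def)
  qed (rule A)
  then obtain c where c: "card A \<le> card (\<Phi> -` {c} \<inter> A) * card (PiE {..<d} (\<lambda>_. R \<times> R))" by blast
  have "card (PiE {..<d} (\<lambda>_. R \<times> R)) = (40 * k + 1) ^ (2 * d)"
  proof -
    have "card R = 40 * k + 1" by (simp add: R_def nat_add_distrib nat_mult_distrib)
    then show ?thesis by (simp add: card_PiE card_cartesian_product power_mult power2_eq_square)
  qed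
  moreover have "card (\<Phi> -` {c} \<inter> A) \<le> card X"
  proof (cases "\<Phi> -` {c} \<inter> A = {}")
    case False
    then obtain a where a: "a \<in> A" "\<Phi> a = c" by blast
    have qd: "\<bar>t - t'\<bar> \<le> 1 / (20 * real k)" if "q t = q t'" for t t'
    proof -
      have "\<bar>20 * real k * t - 20 * real k * t'\<bar> \<le> 1"
        using that unfolding q_def by linarith
      then have "20 * real k * \<bar>t - t'\<bar> \<le> 1" by (simp add: abs_mult flip: right_diff_distrib)
      then show ?thesis using k by (simp add: field_simps)
    qed
    have "b - a \<in> X" if b: "b \<in> A" "\<Phi> b = c" for b
    proof -
      have "b + - a \<in> A + uminus ` A" using a b by blast
      then have "b - a \<in> mixsum 1 1 A" by (simp add: mixsum_def)
      then have "b - a \<in> mixsum 3 3 A" using mixsum_subset_mixsum[OF A(2), of 1 1 2] by (auto simp: numeral_3_eq_3)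
      moreover have "cmod (\<psi> j (b - a) - 1) \<le> 1 / (10 * real k)" if j: "j < d" for j
      proof -
        have "\<Phi> b j = \<Phi> a j" using a b by simp
        then have "\<bar>Re (\<psi> j b) - Re (\<psi> j a)\<bar> \<le> 1 / (20 * real k)" "\<bar>Im (\<psi> j b) - Im (\<psi> j a)\<bar> \<le> 1 / (20 * real k)"
          using j by (auto simp: \<Phi>_def intro: qd)
        then have "cmod (\<psi> j b - \<psi> j a) \<le> 1 / (20 * real k) + 1 / (20 * real k)"
          using cmod_le[of "\<psi> j b - \<psi> j a"] by simp
        moreover have "\<psi> j b - \<psi> j a = \<psi> j a * (\<psi> j (b - a) - 1)"
          using character_add[OF \<psi>(1)[OF j], of a "b - a"] by (simp add: algebra_simps)
        then have "cmod (\<psi> j b - \<psi> j a) = cmod (\<psi> j (b - a) - 1)"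
          using \<psi>(1)[OF j] by (simp add: norm_mult)
        ultimately show ?thesis by simp
      qed
      ultimately show ?thesis by (simp add: X_def)
    qed
    then show ?thesis
      using fin by (intro card_inj_on_le[where f = "\<lambda>b. b - a"]) (auto simp: inj_on_def)
  qed simp
  ultimately have "card A \<le> card X * (40 * k + 1) ^ (2 * d)"
    using c by (metis mult_le_mono1 order_trans)
  then show ?thesis using that 0 symX sub by blast
qed

text \<open>Every \<open>a\<close> in \<open>A\<close> lies in \<open>g + Z\<close> for exactly
  \<open>|Z|\<close> values of \<open>g\<close>, all of them in \<open>A - Z\<close>; some
  \<open>g\<close> reaches the average.\<close>

lemma exists_popular_translate:
  fixes A Z :: "'a::ab_group_add set"
  assumes A: "finite A" "A \<noteq> {}" and Z: "finite Z" "Z \<noteq> {}"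
  obtains g where "g \<in> A + uminus ` Z" 
    "card A * card Z \<le> card (A + uminus ` Z) * card (A \<inter> ({g} + Z))"
proof -
  define S where "S = A + uminus ` Z"
  have fS: "finite S" using A Z by (simp add: S_def finite_set_plus)
  have mem: "a \<in> {g} + Z \<longleftrightarrow> a - g \<in> Z" for a g
    by (auto simp: set_plus_def intro!: bexI[of _ "a - g"])
  have "(\<Sum>g\<in>S. card (A \<inter> ({g} + Z))) = (\<Sum>g\<in>S. \<Sum>a\<in>A. of_bool (a - g \<in> Z))"
    using A by (intro sum.cong) (auto simp: mem Int_def)
  also have "\<dots> = (\<Sum>a\<in>A. card {g\<in>S. a - g \<in> Z})"
    using fS by (subst sum.swap) (simp add: Int_def)
  also have "\<dots> = (\<Sum>a\<in>A. card Z)"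
  proof (rule sum.cong[OF refl])
    fix a assume a: "a \<in> A"
    have "{g\<in>S. a - g \<in> Z} = (\<lambda>z. a - z) ` Z"
    proof -
      have "a - z \<in> S" if "z \<in> Z" for z
        unfolding S_def using a that by (metis diff_conv_add_uminus imageI set_plus_intro)
      then show ?thesis by (auto simp: image_iff) (metis diff_diff_eq2 add_diff_cancel_left')
    qed
    then show "card {g\<in>S. a - g \<in> Z} = card Z" by (simp add: card_image inj_on_def)
  qed
  finally have sum: "(\<Sum>g\<in>S. card (A \<inter> ({g} + Z))) = card A * card Z" by simp
  have "\<exists>g\<in>S. card A * card Z \<le> card S * card (A \<inter> ({g} + Z))"
  proof -
    define m where "m = Max ((\<lambda>g. card (A \<inter> ({g} + Z))) ` S)"
    have "S \<noteq> {}" using A Z by (auto simp: S_def set_plus_def)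
    then have "m \<in> (\<lambda>g. card (A \<inter> ({g} + Z))) ` S" using fS by (auto simp: m_def)
    then obtain g where g: "g \<in> S" "m = card (A \<inter> ({g} + Z))" by blast
    have "(\<Sum>g\<in>S. card (A \<inter> ({g} + Z))) \<le> (\<Sum>g\<in>S. m)"
      using fS by (intro sum_mono) (simp add: m_def)
    then show ?thesis using g sum by auto
  qed
  then show ?thesis using that by (auto simp: S_def)
qed

lemma four_power: "(4::real) ^ m = 2 ^ (2 * m)"
  by (simp add: power_mult)

lemma polynomial_growth_of_bohr_set:
  fixes A :: "'a::ab_group_add set" and K :: real
  assumes A: "finite A" "A \<noteq> {}" and K: "K \<ge> 1" "real (card (A + A)) \<le> K * card A"
    and d: "d \<ge> 1" "K \<le> 4 ^ d"
    and \<psi>: "\<And>j. j < d \<Longrightarrow> character (\<psi> j)"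
      "\<And>x. x \<in> mixsum 6 6 A \<Longrightarrow> (\<And>j. j < d \<Longrightarrow> cmod (\<psi> j x - 1) \<le> 1 / 10) \<Longrightarrow> x \<in> mixsum 3 3 A"
  obtains X where "0 \<in> X" "uminus ` X = X" "X \<subseteq> mixsum 3 3 A" "X + X \<subseteq> mixsum 3 3 A"
    "card A \<le> 2 ^ (32 * d\<^sup>2) * card X"
    "\<forall>n\<ge>1. card (nsum n X) \<le> n ^ (320 * d\<^sup>2) * card X"
proof -
  \<comment> \<open>Covering needs control of \<open>(3r + 1)X\<close>, hence the value of
    \<open>k\<close>. It also needs \<open>2 ^ r\<close> to beat
    \<open>|3A - 3A| / |X| \<le> 2 ^ (44 * d\<^sup>2)\<close>; since \<open>k\<close> enters this
    ratio only as a power with exponent of order \<open>d\<close>, a quadratic \<open>r\<close> is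
    ample.\<close>
  define r where "r = 64 * d\<^sup>2"
  define k where "k = 3 * r + 1"
  have k: "k \<ge> 1" "2 \<le> k" "1 \<le> k" using d by (auto simp: k_def r_def)
  obtain X where X: "0 \<in> X" "uminus ` X = X" "\<forall>m\<le>k. nsum m X \<subseteq> mixsum 3 3 A"
    "card A \<le> card X * (40 * k + 1) ^ (2 * d)"
    by (rule bohr_set_structure[OF A k(1) \<psi>])
  have X1: "X \<subseteq> mixsum 3 3 A" and X2: "nsum 2 X \<subseteq> mixsum 3 3 A"
    using X(3)[rule_format, of 1] X(3)[rule_format, of 2] k by simp_all
  have fin: "finite X" using X1 A finite_mixsum by (blast intro: finite_subset)
  have dd: "d \<le> d\<^sup>2" "1 \<le> d\<^sup>2" using d by (auto simp: power2_eq_square)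
  have "40 * k + 1 \<le> 2 ^ (14 + 2 * d)"
  proof -
    have "40 * k + 1 \<le> 2 ^ 14 * d\<^sup>2" using dd by (simp add: k_def r_def)
    also have "\<dots> \<le> 2 ^ 14 * (2 ^ d)\<^sup>2"
      by (intro mult_left_mono power_mono) (auto simp: less_imp_le)
    also have "\<dots> = 2 ^ (14 + 2 * d)" by (simp add: power_add power_mult[symmetric] mult.commute)
    finally show ?thesis .
  qed
  then have "(40 * k + 1) ^ (2 * d) \<le> (2 ^ (14 + 2 * d)) ^ (2 * d)" by (rule power_mono) simp
  also have "\<dots> = (2::nat) ^ (28 * d + 4 * d\<^sup>2)"
    by (simp add: power_mult[symmetric] algebra_simps power2_eq_square)
  also have "\<dots> \<le> 2 ^ (32 * d\<^sup>2)" using dd by (intro power_increasing) auto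
  finally have grid: "(40 * k + 1) ^ (2 * d) \<le> 2 ^ (32 * d\<^sup>2)" .
  have cA: "card A \<le> 2 ^ (32 * d\<^sup>2) * card X"
    using order_trans[OF X(4) mult_le_mono2[OF grid, of "card X"]] by (simp only: mult.commute)
  have D: "card (mixsum 3 3 A) \<le> 2 ^ (44 * d\<^sup>2) * card X"
  proof -
    have "real (card (mixsum 3 3 A)) \<le> K ^ 6 * card A" using card_mixsum_le[OF A K, of 3 3] by simp
    also have "\<dots> \<le> ((4 :: real) ^ d) ^ 6 * real (card A)" using K d by (intro mult_right_mono power_mono) auto
    also have "(4 ^ d) ^ 6 = (2 :: real) ^ (12 * d)"
      unfolding four_power power_mult[symmetric] by (simp add: mult.commute)
    finally have "card (mixsum 3 3 A) \<le> 2 ^ (12 * d) * card A"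
      by (metis of_nat_le_iff of_nat_mult of_nat_numeral of_nat_power)
    also have "\<dots> \<le> 2 ^ (12 * d) * (2 ^ (32 * d\<^sup>2) * card X)" using cA by (rule mult_le_mono2)
    also have "\<dots> = 2 ^ (12 * d + 32 * d\<^sup>2) * card X" by (simp add: power_add)
    also have "\<dots> \<le> 2 ^ (44 * d\<^sup>2) * card X"
      using dd by (intro mult_right_mono power_increasing) auto
    finally show ?thesis .
  qed
  have cX: "card X > 0" using X(1) fin by (auto simp: card_gt_0_iff)
  have le: "card (nsum m X) \<le> 2 ^ (44 * d\<^sup>2) * card X" if "m \<le> k" for m
    using card_mono[OF finite_mixsum[OF A(1), of 3 3], of "nsum m X"] X(3) that D by fastforce
  have "card (nsum (3 * r + 1) X) \<le> 2 ^ (44 * d\<^sup>2) * card X" using le[of k] by (simp add: k_def)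
  also have "\<dots> < 2 ^ r * card X"
    using cX d(1) by (intro mult_strict_right_mono power_strict_increasing) (auto simp: r_def)
  finally obtain ss where ss: "length ss < r" "nsum 3 X \<subseteq> (cube ss + uminus ` cube ss) + nsum 2 X"
    using chang_covering[OF fin X(1,2)] by blast
  have growth: "card (nsum n X) \<le> n ^ (320 * d\<^sup>2) * card X" if n: "n \<ge> 1" for n
  \<comment> \<open>The estimate \<open>n + 1 \<le> n\<^sup>2\<close> fails at \<open>n = 1\<close>,
    where the claim is trivial.\<close>
  proof (cases "n = 1")
    case False
    then have n2: "n \<ge> 2" using n by simp
    then have "2 * n \<le> n * n" by (rule mult_le_mono1)
    then have nn: "n + 1 \<le> n\<^sup>2" using n2 unfolding power2_eq_square by linarith
    have "card (nsum n X) \<le> (n + 1) ^ (2 * length ss) * card (nsum 2 X)"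
      by (rule card_nsum_le_of_covering[OF fin X(1) ss(2)])
    \<comment> \<open>The cube contributes the exponent \<open>4 * r\<close>, and
      \<open>2 ^ r \<le> n ^ r\<close> another \<open>r\<close>; together
      \<open>5 * r = 320 * d\<^sup>2\<close>.\<close>
    also have "\<dots> \<le> (n\<^sup>2) ^ (2 * r) * (n ^ r * card X)"
    proof (rule mult_le_mono)
      have "(n + 1) ^ (2 * length ss) \<le> (n + 1) ^ (2 * r)" using ss(1) by (intro power_increasing) auto
      also have "\<dots> \<le> (n\<^sup>2) ^ (2 * r)" using nn by (rule power_mono) simp
      finally show "(n + 1) ^ (2 * length ss) \<le> (n\<^sup>2) ^ (2 * r)" .
      have "card (nsum 2 X) \<le> 2 ^ (44 * d\<^sup>2) * card X" using le[OF k(2)] .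
      also have "\<dots> \<le> 2 ^ r * card X" by (intro mult_right_mono power_increasing) (auto simp: r_def)
      also have "\<dots> \<le> n ^ r * card X" using n2 by (intro mult_right_mono power_mono) auto
      finally show "card (nsum 2 X) \<le> n ^ r * card X" .
    qed
    also have "\<dots> = n ^ (320 * d\<^sup>2) * card X"
      by (simp add: r_def power_mult[symmetric] power_add[symmetric] mult.assoc[symmetric])
    finally show ?thesis .
  qed simp
  have "X + X \<subseteq> mixsum 3 3 A" using X2 by (simp add: numeral_2_eq_2)
  then show ?thesis using that X(1,2) X1 cA growth by blast
qed

lemma nat_ceiling_bounds:
  fixes x :: real
  assumes "x \<ge> 0"
  shows "x \<le> real (nat \<lceil>x\<rceil>)" "real (nat \<lceil>x\<rceil>) \<le> x + 1"
  using assms by linarith+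

lemma exists_parameters:
  fixes K :: real
  assumes K: "K \<ge> 1"
  obtains n l d :: nat where "n \<ge> 1" "(65 / 64) ^ n > 2 * K"
    "l \<ge> 1" "2 * K ^ 3 * exp (- (real l * (1 / (4 * real n))\<^sup>2 / 16)) \<le> 1 / 512"
    "9 * K ^ (14 + l) < exp (real d / 256)"
    "1 + ln K \<le> real d" "real d \<le> 8 * 10 ^ 9 * (1 + ln K) ^ 4"
proof -
  define L where "L = 1 + ln K"
  have L: "L \<ge> 1" "exp L = exp 1 * K" using K by (auto simp: L_def exp_add)
  have e2: "exp 1 \<ge> (2::real)" using exp_ge_add_one_self[of 1] by simp
  \<comment> \<open>Since \<open>(65 / 64) ^ n \<ge> exp (n / 65)\<close> and
    \<open>2 * K \<le> exp L\<close>, anything above \<open>65 * L\<close> would do.\<close>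
  define n where "n = nat \<lceil>100 * L\<rceil>"
  have n: "real n \<ge> 100 * L" "real n \<le> 101 * L" "n \<ge> 1" using L(1) by (auto simp: n_def) linarith+
  have "1 - 1 / 65 \<le> exp (- (1 / 65) :: real)" using exp_ge_add_one_self[of "- (1 / 65) :: real"] by simp
  then have "exp (1 / 65) \<le> (65 / 64 :: real)" by (simp add: exp_minus field_simps)
  have "2 * K \<le> exp L" using L e2 K by (simp add: mult_right_mono)
  moreover have "L < real n * (1 / 65)" using n(1) L(1) by linarith
  ultimately have "2 * K < exp (real n * (1 / 65))" by (meson exp_less_cancel_iff le_less_trans)
  also have "\<dots> = exp (1 / 65) ^ n" by (rule exp_of_nat_mult)
  also have "\<dots> \<le> (65 / 64) ^ n" using \<open>exp (1 / 65) \<le> 65 / 64\<close> by (intro power_mono) auto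
  finally have nK: "2 * K < (65 / 64) ^ n" .
  \<comment> \<open>The exponent \<open>l / (256 * n\<^sup>2)\<close> becomes at least
    \<open>10 * L\<close>, and
    \<open>2 * K ^ 3 / (e * K) ^ 10 \<le> 2 / 2 ^ 10 = 1 / 512\<close>.\<close>
  define l where "l = nat \<lceil>2560 * (real n)\<^sup>2 * L\<rceil>"
  have "2560 * 1 * 1 \<le> 2560 * (real n)\<^sup>2 * L" using n L by (intro mult_mono) auto
  then have l: "real l \<ge> 2560 * (real n)\<^sup>2 * L" "real l \<le> 2560 * (real n)\<^sup>2 * L + 1" "l \<ge> 1"
    by (auto simp: l_def) linarith+
  have "1 * 1 \<le> (real n)\<^sup>2 * L" using n L by (intro mult_mono) auto
  then have "real l \<le> 2561 * ((real n)\<^sup>2 * L)" using l by simp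
  also have "\<dots> \<le> 2561 * ((101 * L)\<^sup>2 * L)"
    using n L by (intro mult_left_mono mult_right_mono power_mono) auto
  also have "\<dots> \<le> 3 * 10 ^ 7 * L ^ 3" using L by (simp add: power2_eq_square power3_eq_cube)
  finally have lL: "real l \<le> 3 * 10 ^ 7 * L ^ 3" .
  have "10 * L \<le> real l * (1 / (4 * real n))\<^sup>2 / 16"
    using l n by (simp add: power2_eq_square field_simps)
  then have "2 * K ^ 3 * exp (- (real l * (1 / (4 * real n))\<^sup>2 / 16)) \<le> 2 * K ^ 3 * exp (- (10 * L))"
    using K by (intro mult_left_mono) auto
  also have "exp (- (10 * L)) = 1 / (exp 1 * K) ^ 10"
    by (simp add: L(2)[symmetric] exp_minus divide_inverse flip: exp_of_nat_mult)
  also have "2 * K ^ 3 * (1 / (exp 1 * K) ^ 10) \<le> 2 * K ^ 3 * (1 / (2 ^ 10 * K ^ 3))"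
  proof (intro mult_left_mono divide_left_mono)
    have "2 ^ 10 * K ^ 3 \<le> exp 1 ^ 10 * K ^ 10"
      using K e2 by (intro mult_mono power_mono power_increasing) auto
    then show "2 ^ 10 * K ^ 3 \<le> (exp 1 * K) ^ 10" by (simp add: power_mult_distrib)
  qed (use K in auto)
  also have "\<dots> = 1 / 512" using K by simp
  finally have lK: "2 * K ^ 3 * exp (- (real l * (1 / (4 * real n))\<^sup>2 / 16)) \<le> 1 / 512" .
  \<comment> \<open>Makes \<open>exp (d / 256)\<close> at least \<open>(e * K) ^ (18 + l)\<close>,
    whose power of \<open>e\<close> absorbs the factor \<open>9\<close>.\<close>
  define d where "d = nat \<lceil>256 * (18 + real l) * L\<rceil>"
  have "1 * 1 \<le> (18 + real l) * L" using L by (intro mult_mono) auto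
  then have "0 \<le> 256 * (18 + real l) * L" using L by (intro mult_nonneg_nonneg) auto
  note dc = nat_ceiling_bounds[OF this, folded d_def]
  have d: "real d \<ge> 256 * (18 + real l) * L" "real d \<le> 257 * ((18 + real l) * L)"
    using dc \<open>1 * 1 \<le> (18 + real l) * L\<close> by (simp, argo)
  have "9 * K ^ (14 + l) < exp 1 ^ (18 + l) * K ^ (18 + l)"
  proof -
    have "2 ^ 4 \<le> (exp 1 :: real) ^ 4" using e2 by (rule power_mono) simp
    also have "\<dots> \<le> exp 1 ^ (18 + l)" using e2 by (intro power_increasing) auto
    finally have "9 < (exp 1 :: real) ^ (18 + l)" by simp
    moreover have "K ^ (14 + l) \<le> K ^ (18 + l)" "0 < K ^ (14 + l)" using K by (auto intro: power_increasing)
    ultimately show ?thesis by (intro mult_less_le_imp_less) auto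
  qed
  also have "\<dots> = exp L ^ (18 + l)" by (simp add: L(2) power_mult_distrib)
  also have "\<dots> = exp ((18 + real l) * L)" by (simp flip: exp_of_nat_mult)
  also have "\<dots> \<le> exp (real d / 256)"
  proof -
    have "(18 + real l) * L \<le> real d / 256" using d(1) by argo
    then show ?thesis by simp
  qed
  finally have dK: "9 * K ^ (14 + l) < exp (real d / 256)" .
  have "1 * L \<le> (256 * (18 + real l)) * L" using L by (intro mult_right_mono) auto
  then have Ld: "L \<le> real d" using d by simp
  have "1 \<le> L ^ 3" using L by simp
  have "real d \<le> 257 * ((18 + 3 * 10 ^ 7 * L ^ 3) * L)"
    using d(2) lL L by (intro order_trans[OF d(2)] mult_left_mono mult_right_mono) auto
  also have "\<dots> \<le> 257 * ((18 * L ^ 3 + 3 * 10 ^ 7 * L ^ 3) * L)"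
    using L \<open>1 \<le> L ^ 3\<close> by (intro mult_left_mono mult_right_mono add_mono) auto
  also have "\<dots> = 257 * (18 + 3 * 10 ^ 7) * L ^ 4" by (simp add: algebra_simps eval_nat_numeral)
  also have "\<dots> \<le> 8 * 10 ^ 9 * L ^ 4" using L by (intro mult_right_mono) auto
  finally show ?thesis
    using that[of n l d] n nK l lK dK Ld by (simp add: L_def)
qed

text \<open>Any value at least \<open>320 * (8 * 10^9)^2\<close> works: the growth exponent is \<open>320 d\<^sup>2\<close>, and
  \<open>d\<close> is at most \<open>8 * 10^9 * L\<^sup>4\<close>.\<close>

definition structure_exponent :: real where "structure_exponent = 10 ^ 23"

text \<open>\<open>X\<close> and \<open>g\<close> are located in sums and differences of
  \<open>A\<close> so that they can later be pulled back to the group generated by \<open>A\<close>,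
  which is only part of the type.\<close>

lemma structure_theorem_qz:
  fixes A :: "('i \<Rightarrow> qz) set" and K :: real
  assumes A: "finite A" "A \<noteq> {}" and K: "K \<ge> 1" "real (card (A + A)) \<le> K * card A"
  defines "C \<equiv> structure_exponent"
  obtains X g where "finite X" "X \<noteq> {}" "X \<subseteq> mixsum 3 3 A" "g \<in> mixsum 4 3 A"
    "real (card (A \<inter> ({g} + (X + uminus ` X)))) \<ge> exp (- (C * (1 + ln K) powr C)) * card A"
    "real (card (A \<inter> ({g} + (X + uminus ` X)))) \<ge> card ({g} + (X + uminus ` X)) / (C * K powr C)"
    "\<forall>n\<ge>1. real (card (nsum n X)) \<le> real n powr (C * (1 + ln K) powr C) * card X"
proof -
  define L where "L = 1 + ln K"
  have L: "L \<ge> 1" "K \<le> exp L" using K by (auto simp: L_def exp_add)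
  obtain n l d where nl: "n \<ge> 1" "(65 / 64) ^ n > 2 * K"
    "l \<ge> 1" "2 * K ^ 3 * exp (- (real l * (1 / (4 * real n))\<^sup>2 / 16)) \<le> 1 / 512"
    "9 * K ^ (14 + l) < exp (real d / 256)"
    and d: "L \<le> real d" "real d \<le> 8 * 10 ^ 9 * L ^ 4"
    unfolding L_def by (rule exists_parameters[OF K(1)])
  obtain \<psi> where \<psi>: "\<And>j. j < d \<Longrightarrow> character (\<psi> j)"
    "\<And>x. x \<in> mixsum 6 6 A \<Longrightarrow> (\<And>j. j < d \<Longrightarrow> cmod (\<psi> j x - 1) \<le> 1 / 10) \<Longrightarrow> x \<in> mixsum 3 3 A"
    using exists_bohr_set[OF A K nl] by blast
  have d1: "d \<ge> 1" using d L by linarith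
  have "K \<le> exp (real d)" using L d by (meson exp_le_cancel_iff order_trans)
  also have "\<dots> = exp 1 ^ d" by (simp flip: exp_of_nat_mult)
  also have "\<dots> \<le> 4 ^ d" using exp_le by (intro power_mono) auto
  finally have Kd: "K \<le> 4 ^ d" .
  obtain X where X: "0 \<in> X" "uminus ` X = X" "X \<subseteq> mixsum 3 3 A" "X + X \<subseteq> mixsum 3 3 A"
    "card A \<le> 2 ^ (32 * d\<^sup>2) * card X"
    and growth: "\<forall>n\<ge>1. card (nsum n X) \<le> n ^ (320 * d\<^sup>2) * card X"
    by (rule polynomial_growth_of_bohr_set[OF A K d1 Kd \<psi>])
  have finX: "finite X" using X(3) A finite_mixsum by (blast intro: finite_subset)
  define Z where "Z = X + uminus ` X"
  have Z: "finite Z" "Z \<noteq> {}" "X \<subseteq> Z" "Z \<subseteq> mixsum 3 3 A"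
    using X finX set_zero_plus2[OF X(1), of X] by (auto simp: Z_def finite_set_plus)
  \<comment> \<open>\<open>A - Z\<close> has at most \<open>K ^ 7 * |A|\<close> points, so a popular
    translate costs a factor \<open>K ^ 7\<close> that does not involve \<open>d\<close>. This
    yields the bound polynomial in \<open>K\<close>.\<close>
  have "A + uminus ` Z \<subseteq> mixsum 1 0 A + uminus ` mixsum 3 3 A"
    using Z by (intro set_plus_mono2 image_mono) auto
  then have S: "A + uminus ` Z \<subseteq> mixsum 4 3 A" unfolding uminus_mixsum mixsum_add by simp
  obtain g where g: "g \<in> A + uminus ` Z"
    "card A * card Z \<le> card (A + uminus ` Z) * card (A \<inter> ({g} + Z))"
    by (rule exists_popular_translate[OF A Z(1,2)])
  define Y where "Y = {g} + Z"
  have cA: "card A > 0" using A by (simp add: card_gt_0_iff)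
  have "real (card A) * card Z \<le> real (card (A + uminus ` Z)) * card (A \<inter> Y)"
    using g(2) unfolding Y_def by (metis of_nat_le_iff of_nat_mult)
  also have "\<dots> \<le> real (card (mixsum 4 3 A)) * card (A \<inter> Y)"
    using S A by (intro mult_right_mono) (auto intro!: card_mono finite_mixsum)
  also have "\<dots> \<le> (K ^ 7 * card A) * card (A \<inter> Y)"
    using card_mixsum_le[OF A K, of 4 3] by (intro mult_right_mono) auto
  finally have ZY: "real (card Z) \<le> K ^ 7 * card (A \<inter> Y)" using cA by simp

  \<comment> \<open>\<open>C \<ge> 8\<close> lets \<open>powr C\<close> dominate both
    \<open>L ^ 8\<close>, from \<open>d\<^sup>2\<close>, and \<open>K ^ 7\<close>.\<close>
  have C: "C \<ge> 8" "C > 0" "C \<ge> 320 * (8 * 10 ^ 9)\<^sup>2" by (auto simp: C_def structure_exponent_def)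
  have "real d ^ 2 \<le> (8 * 10 ^ 9 * L ^ 4)\<^sup>2" using d by (intro power_mono) auto
  also have "\<dots> = (8 * 10 ^ 9)\<^sup>2 * L ^ 8" by (simp add: power_mult_distrib flip: power_mult)
  finally have "320 * real d ^ 2 \<le> (320 * (8 * 10 ^ 9)\<^sup>2) * L ^ 8" by simp
  also have "\<dots> \<le> C * L powr C"
  proof (intro mult_mono)
    have "L ^ 8 = L powr 8" using L by (simp add: powr_numeral)
    also have "\<dots> \<le> L powr C" using L C by (intro powr_mono) auto
    finally show "L ^ 8 \<le> L powr C" .
  qed (use C L in auto)
  finally have dC: "320 * real d ^ 2 \<le> C * L powr C" .

  have b2: "real (card Y) / (C * K powr C) \<le> card (A \<inter> Y)"
  proof -
    have "K ^ 7 = K powr 7" using K by (simp add: powr_numeral)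
    also have "\<dots> \<le> K powr C" using K C by (intro powr_mono) auto
    also have "\<dots> \<le> C * K powr C" using C mult_right_mono[of 1 C "K powr C"] by simp
    finally have "K ^ 7 * card (A \<inter> Y) \<le> (C * K powr C) * card (A \<inter> Y)" by (rule mult_right_mono) simp
    then have "real (card Y) \<le> (C * K powr C) * card (A \<inter> Y)"
      using ZY by (simp add: Y_def card_set_plus_sing)
    then show ?thesis using K C by (simp add: field_simps)
  qed
  have b1: "exp (- (C * L powr C)) * card A \<le> card (A \<inter> Y)"
  proof -
    have dd: "d \<le> d\<^sup>2" using d1 by (simp add: power2_eq_square)
    have "real (card A) \<le> 2 ^ (32 * d\<^sup>2) * real (card X)"
      using X(5) by (metis of_nat_le_iff of_nat_mult of_nat_numeral of_nat_power)
    also have "\<dots> \<le> 2 ^ (32 * d\<^sup>2) * real (card Z)"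
      using card_mono[OF Z(1,3)] by (intro mult_left_mono) auto
    also have "\<dots> \<le> 2 ^ (32 * d\<^sup>2) * (K ^ 7 * card (A \<inter> Y))"
      using ZY by (intro mult_left_mono) auto
    also have "\<dots> \<le> 2 ^ (32 * d\<^sup>2) * ((4 ^ d) ^ 7 * real (card (A \<inter> Y)))"
      using Kd K by (intro mult_left_mono mult_right_mono power_mono) auto
    also have "\<dots> = 2 ^ (32 * d\<^sup>2) * (2 ^ (14 * d) * real (card (A \<inter> Y)))"
      unfolding four_power power_mult[symmetric] by (simp add: mult.commute)
    also have "\<dots> = 2 ^ (32 * d\<^sup>2 + 14 * d) * real (card (A \<inter> Y))" by (simp add: power_add)
    \<comment> \<open>Deliberately coarse, so that \<open>dC\<close> serves this bound as well as
      the growth bound.\<close>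
    also have "\<dots> \<le> 2 ^ (320 * d\<^sup>2) * real (card (A \<inter> Y))"
      using dd by (intro mult_right_mono power_increasing) auto
    also have "\<dots> \<le> exp 1 ^ (320 * d\<^sup>2) * card (A \<inter> Y)"
      using exp_ge_add_one_self[of 1] by (intro mult_right_mono power_mono) auto
    also have "\<dots> = exp (320 * real d ^ 2) * card (A \<inter> Y)" by (simp flip: exp_of_nat_mult)
    also have "\<dots> \<le> exp (C * L powr C) * card (A \<inter> Y)" using dC by (intro mult_right_mono) auto
    finally show ?thesis by (simp add: exp_minus field_simps)
  qed
  have b3: "real (card (nsum n X)) \<le> real n powr (C * L powr C) * card X" if n: "n \<ge> 1" for n
  proof -
    have "real (card (nsum n X)) \<le> real n ^ (320 * d\<^sup>2) * card X"
      using growth n by (metis of_nat_le_iff of_nat_mult of_nat_power)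
    also have "real n ^ (320 * d\<^sup>2) = real n powr (320 * real d ^ 2)"
      using n powr_realpow[of "real n" "320 * d\<^sup>2"] by simp
    also have "\<dots> \<le> real n powr (C * L powr C)" using n dC by (intro powr_mono) auto
    finally show ?thesis by (simp add: mult_right_mono)
  qed
  show ?thesis
    using that[of X g] finX X(1,3) g(1) S b1 b2 b3 by (auto simp: Y_def Z_def L_def)
qed

section \<open>Transport along injective homomorphisms\<close>

text \<open>The conclusion of \<open>structure_const\<close> with its witnesses exposed, so that it
  can be carried along homomorphisms.\<close>

definition structured_pair :: "real \<Rightarrow> ('a, 'b) monoid_scheme \<Rightarrow> 'a set \<Rightarrow> real \<Rightarrow> 'a set \<Rightarrow> 'a set \<Rightarrow> bool" where
  "structured_pair C G A K X Y \<longleftrightarrow> X \<subseteq> carrier G \<and> finite X \<and> X \<noteq> {} \<and>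
    (\<exists>g\<in>carrier G. Y = g <#\<^bsub>G\<^esub> diffset G X X) \<and>
    real (card (A \<inter> Y)) \<ge> exp (- (C * (1 + ln K) powr C)) * real (card A) \<and>
    real (card (A \<inter> Y)) \<ge> real (card Y) / (C * K powr C) \<and>
    (\<forall>n::nat. n \<ge> 1 \<longrightarrow>
      real (card (nfold_sumset G n X)) \<le> real n powr (C * (1 + ln K) powr C) * real (card X))"

lemma structure_const_iff:
  "structure_const C G \<longleftrightarrow> (\<forall>A K. A \<subseteq> carrier G \<longrightarrow> finite A \<longrightarrow> A \<noteq> {} \<longrightarrow> K \<ge> 1 \<longrightarrow>
    real (card (A <#>\<^bsub>G\<^esub> A)) \<le> K * real (card A) \<longrightarrow> (\<exists>X Y. structured_pair C G A K X Y))"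
  by (simp add: structure_const_def structured_pair_def)

lemma (in comm_group) nfold_sumset_0: "nfold_sumset G 0 X = {\<one>}"
  by (auto simp: nfold_sumset_def)

lemma (in comm_group) nfold_sumset_Suc:
  assumes X: "X \<subseteq> carrier G"
  shows "nfold_sumset G (Suc n) X = X <#> nfold_sumset G n X"
proof -
  have ins: "{1..Suc n} = insert (Suc n) {1..n}" by auto
  show ?thesis
  proof (intro equalityI subsetI)
    fix y assume "y \<in> nfold_sumset G (Suc n) X"
    then obtain x where x: "x \<in> {1..Suc n} \<rightarrow> X" "y = finprod G x {1..Suc n}"
      by (auto simp: nfold_sumset_def)
    have "x \<in> {1..n} \<rightarrow> carrier G" "x (Suc n) \<in> X" "x (Suc n) \<in> carrier G" using x(1) X by auto
    then have "y = x (Suc n) \<otimes> finprod G x {1..n}"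
      unfolding x(2) ins by (intro finprod_insert) auto
    moreover have "finprod G x {1..n} \<in> nfold_sumset G n X"
      using x(1) by (force simp: nfold_sumset_def)
    ultimately show "y \<in> X <#> nfold_sumset G n X"
      using \<open>x (Suc n) \<in> X\<close> by (auto simp: set_mult_def)
  next
    fix y assume "y \<in> X <#> nfold_sumset G n X"
    then obtain a x where x: "a \<in> X" "x \<in> {1..n} \<rightarrow> X" "y = a \<otimes> finprod G x {1..n}"
      by (auto simp: nfold_sumset_def set_mult_def)
    define x' where "x' = x(Suc n := a)"
    have "x' \<in> {1..n} \<rightarrow> carrier G" "x' (Suc n) = a" "a \<in> carrier G" using x X by (auto simp: x'_def)
    then have "finprod G x' {1..Suc n} = a \<otimes> finprod G x' {1..n}"
      unfolding ins by (subst finprod_insert) auto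
    also have "finprod G x' {1..n} = finprod G x {1..n}"
      using x(2) X by (intro finprod_cong') (auto simp: x'_def)
    finally have "y = finprod G x' {1..Suc n}" using x(3) by simp
    moreover have "x' \<in> {1..Suc n} \<rightarrow> X" using x by (auto simp: x'_def)
    ultimately show "y \<in> nfold_sumset G (Suc n) X" unfolding nfold_sumset_def by blast
  qed
qed

lemma (in comm_group) nfold_sumset_subset: "X \<subseteq> carrier G \<Longrightarrow> nfold_sumset G n X \<subseteq> carrier G"
  by (auto simp: nfold_sumset_def intro!: finprod_closed)

lemma (in comm_group) comm_group_subgroup:
  assumes "subgroup H G"
  shows "comm_group (G\<lparr>carrier := H\<rparr>)"
proof -
  interpret H: group "G\<lparr>carrier := H\<rparr>" using subgroup.subgroup_is_group[OF assms] is_group by blast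
  show ?thesis
    by (rule H.group_comm_groupI) (use subgroup.subset[OF assms] m_comm in auto)
qed

context
  fixes N :: "('a, 'c) monoid_scheme" and G :: "('b, 'd) monoid_scheme" and h :: "'a \<Rightarrow> 'b"
  assumes N: "comm_group N" and G: "comm_group G" and h: "h \<in> hom N G" "inj_on h (carrier N)"
begin

lemma group_hom_h: "group_hom N G h"
  using N G h(1) by (simp add: group_hom_def group_hom_axioms_def comm_group.axioms(2))

lemma hom_image_set_mult:
  assumes "S \<subseteq> carrier N" "T \<subseteq> carrier N"
  shows "h ` (S <#>\<^bsub>N\<^esub> T) = h ` S <#>\<^bsub>G\<^esub> h ` T"
proof -
  have "h (s \<otimes>\<^bsub>N\<^esub> t) = h s \<otimes>\<^bsub>G\<^esub> h t" if "s \<in> S" "t \<in> T" for s t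
    by (rule hom_mult[OF h(1)]) (use that assms in auto)
  then show ?thesis by (force simp: set_mult_def)
qed

lemma hom_image_diffset:
  assumes "S \<subseteq> carrier N" "T \<subseteq> carrier N"
  shows "h ` diffset N S T = diffset G (h ` S) (h ` T)"
proof -
  interpret group_hom N G h by (rule group_hom_h)
  have "set_inv\<^bsub>N\<^esub> T \<subseteq> carrier N" using assms by (auto simp: SET_INV_def)
  moreover have "h ` (set_inv\<^bsub>N\<^esub> T) = set_inv\<^bsub>G\<^esub> (h ` T)"
    using assms by (force simp: SET_INV_def)
  ultimately show ?thesis using assms by (simp add: diffset_def hom_image_set_mult)
qed

lemma hom_image_nfold_sumset:
  assumes "X \<subseteq> carrier N"
  shows "h ` nfold_sumset N n X = nfold_sumset G n (h ` X)"
proof (induction n)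
  case 0
  interpret group_hom N G h by (rule group_hom_h)
  show ?case by (simp add: comm_group.nfold_sumset_0[OF N] comm_group.nfold_sumset_0[OF G])
next
  case (Suc n)
  interpret group_hom N G h by (rule group_hom_h)
  have "h ` X \<subseteq> carrier G" using assms by auto
  then show ?case
    using Suc assms comm_group.nfold_sumset_subset[OF N assms]
    by (simp add: comm_group.nfold_sumset_Suc[OF N] comm_group.nfold_sumset_Suc[OF G] hom_image_set_mult)
qed

text \<open>All quantities involved are cardinalities of sets built from products and inverses,
  which an injective homomorphism preserves; injectivity also makes images commute with
  \<open>A \<inter> Y\<close>.\<close>

lemma structured_pair_hom_image:
  assumes A: "A \<subseteq> carrier N" and XY: "structured_pair C N A K X Y"
  shows "structured_pair C G (h ` A) K (h ` X) (h ` Y)"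
proof -
  interpret group_hom N G h by (rule group_hom_h)
  interpret N: comm_group N by (rule N)
  have X: "X \<subseteq> carrier N" using XY by (simp add: structured_pair_def)
  obtain g where g: "g \<in> carrier N" "Y = g <#\<^bsub>N\<^esub> diffset N X X"
    using XY by (auto simp: structured_pair_def)
  have D: "diffset N X X \<subseteq> carrier N"
    using X by (auto simp: diffset_def set_mult_def SET_INV_def)
  have Y: "Y \<subseteq> carrier N" using g D by (auto simp: l_coset_def)
  have "h ` Y = h ` ({g} <#>\<^bsub>N\<^esub> diffset N X X)"
    unfolding g(2) by (simp add: l_coset_eq_set_mult)
  also have "\<dots> = h g <#\<^bsub>G\<^esub> diffset G (h ` X) (h ` X)"
    using g(1) D X by (simp add: hom_image_set_mult hom_image_diffset l_coset_eq_set_mult)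
  finally have hY: "h ` Y = h g <#\<^bsub>G\<^esub> diffset G (h ` X) (h ` X)" .
  have nc: "nfold_sumset N n X \<subseteq> carrier N" for n
    using X by (auto simp: nfold_sumset_def intro!: N.finprod_closed)
  have card: "card (h ` S) = card S" if "S \<subseteq> carrier N" for S
    using h(2) that by (meson card_image inj_on_subset)
  have "h ` A \<inter> h ` Y = h ` (A \<inter> Y)"
    using inj_on_image_Int[OF h(2) A Y] by simp
  moreover have "A \<inter> Y \<subseteq> carrier N" using A by blast
  ultimately have "card (h ` A \<inter> h ` Y) = card (A \<inter> Y)" by (simp add: card)
  moreover have "card (nfold_sumset G n (h ` X)) = card (nfold_sumset N n X)" for n
    using card[OF nc] hom_image_nfold_sumset[OF X] by metis
  moreover have "h ` X \<subseteq> carrier G" "h g \<in> carrier G" using X g(1) by auto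
  ultimately show ?thesis
    using XY hY card[OF X] card[OF Y] card[OF A] unfolding structured_pair_def by auto
qed

end

text \<open>The group structure copied along \<open>f\<close> onto its image. It moves a subgroup
  into a power of \<open>qz\<close>, where the combinatorics is available, or into
  \<open>nat\<close>, where a given constant is assumed to work.\<close>

definition image_group :: "('a \<Rightarrow> 'b) \<Rightarrow> ('a, 'c) monoid_scheme \<Rightarrow> 'b monoid" where
  "image_group f G = \<lparr>carrier = f ` carrier G,
    monoid.mult = (\<lambda>x y. f (inv_into (carrier G) f x \<otimes>\<^bsub>G\<^esub> inv_into (carrier G) f y)), one = f \<one>\<^bsub>G\<^esub>\<rparr>"

lemma
  assumes G: "comm_group G" and f: "inj_on f (carrier G)"
  shows comm_group_image_group: "comm_group (image_group f G)"
    and inv_into_hom_image_group: "inv_into (carrier G) f \<in> hom (image_group f G) G"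
proof -
  interpret comm_group G by (rule G)
  show "comm_group (image_group f G)"
  proof (rule comm_groupI)
    fix x assume "x \<in> carrier (image_group f G)"
    then obtain a where a: "a \<in> carrier G" "x = f a" by (auto simp: image_group_def)
    then show "\<exists>y\<in>carrier (image_group f G). y \<otimes>\<^bsub>image_group f G\<^esub> x = \<one>\<^bsub>image_group f G\<^esub>"
      using f by (intro bexI[of _ "f (inv\<^bsub>G\<^esub> a)"]) (auto simp: image_group_def)
  qed (use f in \<open>auto simp: image_group_def m_ac\<close>)
  show "inv_into (carrier G) f \<in> hom (image_group f G) G"
    using f by (auto simp: hom_def image_group_def)
qed

text \<open>The pair found in the copy is pulled back by \<open>inv_into H f\<close>, an injective
  homomorphism from the copy into \<open>G\<close>.\<close>

lemma structured_pair_via_embedding: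
  assumes G: "comm_group G" and H: "subgroup H G" and f: "inj_on f H" and A: "A \<subseteq> H"
    and XY: "structured_pair C (image_group f (G\<lparr>carrier := H\<rparr>)) (f ` A) K X Y"
  shows "\<exists>X Y. structured_pair C G A K X Y"
proof -
  let ?H = "G\<lparr>carrier := H\<rparr>"
  let ?h = "inv_into H f"
  have GH: "comm_group ?H" using comm_group.comm_group_subgroup[OF G H] .
  have N: "comm_group (image_group f ?H)" "?h \<in> hom (image_group f ?H) ?H"
    using comm_group_image_group[OF GH] inv_into_hom_image_group[OF GH] f by auto
  then have "?h \<in> hom (image_group f ?H) G"
    using subgroup.subset[OF H] by (auto simp: hom_def)
  moreover have "inj_on ?h (carrier (image_group f ?H))"
    by (simp add: image_group_def inj_on_inv_into)
  moreover have "f ` A \<subseteq> carrier (image_group f ?H)" using A by (auto simp: image_group_def)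
  moreover have "?h ` f ` A = A" using f A by (simp add: inv_into_image_cancel)
  ultimately show ?thesis
    using structured_pair_hom_image[OF N(1) G _ _ _ XY, of ?h] by auto
qed

lemma doubling_image_group:
  assumes G: "comm_group G" and H: "subgroup H G" and f: "inj_on f H" and A: "A \<subseteq> H"
  shows "card (f ` A <#>\<^bsub>image_group f (G\<lparr>carrier := H\<rparr>)\<^esub> f ` A) = card (A <#>\<^bsub>G\<^esub> A)"
proof -
  have AA: "A <#>\<^bsub>G\<^esub> A \<subseteq> H" using A subgroup.m_closed[OF H] by (fastforce simp: set_mult_def)
  have "f ` A <#>\<^bsub>image_group f (G\<lparr>carrier := H\<rparr>)\<^esub> f ` A = f ` (A <#>\<^bsub>G\<^esub> A)"
    using A f by (force simp: set_mult_def image_group_def subset_iff)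
  then show ?thesis using AA f by (metis card_image inj_on_subset)
qed

section \<open>Groups whose multiplication is the addition of the surrounding type\<close>

context
  fixes N :: "('g::ab_group_add, 'z) monoid_scheme"
  assumes N: "comm_group N"
    and add: "\<And>x y. x \<in> carrier N \<Longrightarrow> y \<in> carrier N \<Longrightarrow> x \<otimes>\<^bsub>N\<^esub> y = x + y"
begin

lemma additive_one: "\<one>\<^bsub>N\<^esub> = 0"
proof -
  interpret comm_group N by (rule N)
  have "\<one>\<^bsub>N\<^esub> + \<one>\<^bsub>N\<^esub> = \<one>\<^bsub>N\<^esub>" using add[of "\<one>\<^bsub>N\<^esub>" "\<one>\<^bsub>N\<^esub>"] by simp
  then show ?thesis by simp
qed

lemma additive_inv: "x \<in> carrier N \<Longrightarrow> inv\<^bsub>N\<^esub> x = - x"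
proof -
  interpret comm_group N by (rule N)
  assume "x \<in> carrier N"
  then have "x + inv\<^bsub>N\<^esub> x = 0" using add[of x "inv\<^bsub>N\<^esub> x"] by (simp add: additive_one)
  then show ?thesis by (metis add.inverse_unique)
qed

lemma additive_set_mult: "S \<subseteq> carrier N \<Longrightarrow> T \<subseteq> carrier N \<Longrightarrow> S <#>\<^bsub>N\<^esub> T = S + T"
  using add by (auto simp: set_mult_def set_plus_def subset_iff)

lemma additive_uminus: "S \<subseteq> carrier N \<Longrightarrow> uminus ` S \<subseteq> carrier N"
proof -
  interpret comm_group N by (rule N)
  assume S: "S \<subseteq> carrier N"
  show ?thesis
  proof clarify
    fix x assume "x \<in> S"
    then have "x \<in> carrier N" using S by blast
    then show "- x \<in> carrier N" using inv_closed additive_inv by metis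
  qed
qed

lemma additive_plus: "S \<subseteq> carrier N \<Longrightarrow> T \<subseteq> carrier N \<Longrightarrow> S + T \<subseteq> carrier N"
proof -
  interpret comm_group N by (rule N)
  assume "S \<subseteq> carrier N" "T \<subseteq> carrier N"
  then show ?thesis using set_mult_closed additive_set_mult by metis
qed

lemma additive_nsum: "S \<subseteq> carrier N \<Longrightarrow> nsum n S \<subseteq> carrier N"
proof -
  interpret comm_group N by (rule N)
  assume S: "S \<subseteq> carrier N"
  have "0 \<in> carrier N" using one_closed additive_one by simp
  then show ?thesis using S by (induction n) (simp_all add: additive_plus)
qed

lemma additive_mixsum: "S \<subseteq> carrier N \<Longrightarrow> mixsum m n S \<subseteq> carrier N"
  unfolding mixsum_def by (intro additive_plus additive_uminus additive_nsum)

lemma additive_diffset: "S \<subseteq> carrier N \<Longrightarrow> T \<subseteq> carrier N \<Longrightarrow> diffset N S T = S + uminus ` T"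
proof -
  assume ST: "S \<subseteq> carrier N" "T \<subseteq> carrier N"
  then have "set_inv\<^bsub>N\<^esub> T = uminus ` T"
    using additive_inv by (force simp: SET_INV_def)
  then show ?thesis using ST by (simp add: diffset_def additive_set_mult additive_uminus)
qed

lemma additive_nfold_sumset: "X \<subseteq> carrier N \<Longrightarrow> nfold_sumset N n X = nsum n X"
  by (induction n)
    (simp_all add: comm_group.nfold_sumset_0[OF N] comm_group.nfold_sumset_Suc[OF N] additive_one
      additive_set_mult additive_nsum)

end

text \<open>Only the finitely generated subgroup \<open>generate G A\<close> matters, and it has an
  additive copy \<open>N\<close> inside a power of \<open>qz\<close>. There the group operations on
  sets agree with those of the type.\<close>

lemma structure_const_structure_exponent:
  assumes G: "comm_group G"
  shows "structure_const structure_exponent G"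
  unfolding structure_const_iff
proof (intro allI impI)
  fix A :: "'a set" and K :: real
  assume A: "A \<subseteq> carrier G" "finite A" "A \<noteq> {}" and K: "K \<ge> 1" "real (card (A <#>\<^bsub>G\<^esub> A)) \<le> K * real (card A)"
  define H where "H = generate G A"
  interpret comm_group G by (rule G)
  have H: "subgroup H G" using A(1) unfolding H_def by (rule generate_is_subgroup)
  have AH: "A \<subseteq> H" by (auto simp: H_def intro: generate.incl)
  obtain \<phi> :: "'a \<Rightarrow> ('a \<Rightarrow> qz) \<Rightarrow> qz" where \<phi>: "inj_on \<phi> H"
    "\<And>x y. x \<in> H \<Longrightarrow> y \<in> H \<Longrightarrow> \<phi> (x \<otimes>\<^bsub>G\<^esub> y) = \<phi> x + \<phi> y"
    unfolding H_def using embed_qz_power[OF A(2,1)] by blast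
  define N where "N = image_group \<phi> (G\<lparr>carrier := H\<rparr>)"
  have carN: "carrier N = \<phi> ` H" by (simp add: N_def image_group_def)
  have N: "comm_group N"
    unfolding N_def using \<phi>(1) by (intro comm_group_image_group comm_group_subgroup H) simp
  have add: "x \<otimes>\<^bsub>N\<^esub> y = x + y" if "x \<in> carrier N" "y \<in> carrier N" for x y
    using that \<phi> by (auto simp: N_def image_group_def)
  have A': "\<phi> ` A \<subseteq> carrier N" "finite (\<phi> ` A)" "\<phi> ` A \<noteq> {}" using A AH by (auto simp: carN)
  have cA': "card (\<phi> ` A) = card A" using \<phi>(1) AH by (meson card_image inj_on_subset)
  have "card (\<phi> ` A + \<phi> ` A) = card (A <#>\<^bsub>G\<^esub> A)"
    using doubling_image_group[OF G H \<phi>(1) AH] additive_set_mult[OF N add A'(1) A'(1)]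
    by (simp add: N_def)
  then have K': "real (card (\<phi> ` A + \<phi> ` A)) \<le> K * card (\<phi> ` A)" using K(2) cA' by simp
  let ?C = structure_exponent
  obtain X g where X: "finite X" "X \<noteq> {}" "X \<subseteq> mixsum 3 3 (\<phi> ` A)" "g \<in> mixsum 4 3 (\<phi> ` A)"
    "real (card (\<phi> ` A \<inter> ({g} + (X + uminus ` X)))) \<ge> exp (- (?C * (1 + ln K) powr ?C)) * card (\<phi> ` A)"
    "real (card (\<phi> ` A \<inter> ({g} + (X + uminus ` X)))) \<ge> card ({g} + (X + uminus ` X)) / (?C * K powr ?C)"
    "\<forall>n\<ge>1. real (card (nsum n X)) \<le> real n powr (?C * (1 + ln K) powr ?C) * card X"
    by (rule structure_theorem_qz[OF A'(2,3) K(1) K'])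
  have XN: "X \<subseteq> carrier N" "g \<in> carrier N"
    using X(3,4) additive_mixsum[OF N add A'(1)] by blast+
  have "diffset N X X = X + uminus ` X" by (rule additive_diffset[OF N add XN(1) XN(1)])
  moreover have "X + uminus ` X \<subseteq> carrier N"
    using XN(1) by (intro additive_plus[OF N add] additive_uminus[OF N add])
  ultimately have "{g} + (X + uminus ` X) = g <#\<^bsub>N\<^esub> diffset N X X"
    using XN(2) additive_set_mult[OF N add, of "{g}" "X + uminus ` X"] by (simp add: l_coset_eq_set_mult)
  then have "structured_pair ?C N (\<phi> ` A) K X ({g} + (X + uminus ` X))"
    unfolding structured_pair_def using X XN additive_nfold_sumset[OF N add XN(1)] by auto
  then show "\<exists>X Y. structured_pair ?C G A K X Y"
    unfolding N_def by (rule structured_pair_via_embedding[OF G H \<phi>(1) AH])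
qed

text \<open>Every element is the value of a word over the finite alphabet of generators and their
  inverses.\<close>

lemma (in comm_group) countable_generate:
  assumes A: "finite A" "A \<subseteq> carrier G"
  shows "countable (generate G A)"
proof -
  define B where "B = A \<union> m_inv G ` A"
  have B: "B \<subseteq> carrier G" using A by (auto simp: B_def)
  define ev where "ev w = foldr (\<otimes>) w \<one>" for w
  have ev_closed: "ev w \<in> carrier G" if "set w \<subseteq> carrier G" for w
    using that by (induction w) (auto simp: ev_def)
  have ev_append: "ev (v @ w) = ev v \<otimes> ev w" if "set v \<subseteq> carrier G" "set w \<subseteq> carrier G" for v w
    using that(1) ev_closed[OF that(2)]
  proof (induction v)
    case (Cons a v)
    then show ?case using ev_closed[of v] by (simp add: ev_def m_assoc)
  qed (simp add: ev_def)
  have "x \<in> ev ` lists B" if "x \<in> generate G A" for x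
    using that
  proof induction
    case one
    show ?case by (rule image_eqI[of _ _ "[]"]) (auto simp: ev_def)
  next
    case (incl h)
    then show ?case using A by (intro image_eqI[of _ _ "[h]"]) (auto simp: ev_def B_def)
  next
    case (inv h)
    then have "h \<in> carrier G" using A by blast
    then show ?case using inv by (intro image_eqI[of _ _ "[m_inv G h]"]) (auto simp: ev_def B_def)
  next
    case (eng h1 h2)
    then obtain v w where "v \<in> lists B" "h1 = ev v" "w \<in> lists B" "h2 = ev w" by blast
    moreover from this have "ev (v @ w) = ev v \<otimes> ev w" using B by (intro ev_append) auto
    ultimately show ?case by (intro image_eqI[of _ _ "v @ w"]) auto
  qed
  then have "generate G A \<subseteq> ev ` lists B" by blast
  moreover have "countable (ev ` lists B)"
    using A by (intro countable_image countable_lists countable_finite) (auto simp: B_def)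
  ultimately show ?thesis by (rule countable_subset)
qed

text \<open>The countable subgroup generated by \<open>A\<close> is copied onto a subset of
  \<open>nat\<close>, and the pair found there is pulled back. The argument is uniform in
  \<open>C\<close>, as the second half of the theorem demands.\<close>

lemma structure_const_transfer:
  assumes nat: "\<And>G :: nat monoid. comm_group G \<Longrightarrow> structure_const C G" and G: "comm_group G"
  shows "structure_const C G"
  unfolding structure_const_iff
proof (intro allI impI)
  fix A K
  assume A: "A \<subseteq> carrier G" "finite A" "A \<noteq> {}" and K: "K \<ge> 1" "real (card (A <#>\<^bsub>G\<^esub> A)) \<le> K * real (card A)"
  interpret comm_group G by (rule G)
  define H where "H = generate G A"
  have H: "subgroup H G" using A(1) unfolding H_def by (rule generate_is_subgroup)
  have AH: "A \<subseteq> H" by (auto simp: H_def intro: generate.incl)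
  define f where "f = to_nat_on H"
  have f: "inj_on f H" using countable_generate[OF A(2,1)] by (simp add: f_def H_def inj_on_to_nat_on)
  define N where "N = image_group f (G\<lparr>carrier := H\<rparr>)"
  have "comm_group N"
    unfolding N_def using f by (intro comm_group_image_group comm_group_subgroup H) simp
  then have "structure_const C N" by (rule nat)
  moreover have "f ` A \<subseteq> carrier N" using AH by (auto simp: N_def image_group_def)
  moreover have "card (f ` A) = card A" using f AH by (meson card_image inj_on_subset)
  moreover have "card (f ` A <#>\<^bsub>N\<^esub> f ` A) = card (A <#>\<^bsub>G\<^esub> A)"
    unfolding N_def by (rule doubling_image_group[OF G H f AH])
  ultimately have "\<exists>X Y. structured_pair C N (f ` A) K X Y"
    using A K unfolding structure_const_iff by simp
  then show "\<exists>X Y. structured_pair C G A K X Y"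
    unfolding N_def using structured_pair_via_embedding[OF G H f AH] by blast
qed

theorem theorem7p2:
  shows "(\<exists>C>0. \<forall>G :: nat monoid. comm_group G \<longrightarrow> structure_const C G) \<and>
    (\<forall>C>0. (\<forall>G :: nat monoid. comm_group G \<longrightarrow> structure_const C G) \<longrightarrow>
            (\<forall>G :: 'a monoid. comm_group G \<longrightarrow> structure_const C G))"
proof -
  have "structure_exponent > 0" by (simp add: structure_exponent_def)
  then show ?thesis
    using structure_const_structure_exponent structure_const_transfer by blast
qed

end
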